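(* Let $\mathcal{A}$ be a category with coequalizers and let $(L,R,\eta,\epsilon)$ be an adjunction with $R:\mathcal{A}\to\mathcal{B}$. Consider the monadic tower $(\mathcal{B}_n,L_n,R_n,U_{n-1,n})$ and the adjoint decomposition $(\mathcal{B}_{[n]},L_{[n]},R_{[n]},U_{[n-1,n]})$ of $(L,R)$, both defined in the context. There is a sequence of functors $\Lambda_n:\mathcal{B}_n\to\mathcal{B}_{[n]}$, $n\in\mathbb{N}$, with $\Lambda_0=\mathrm{Id}_{\mathcal{B}}$ and $\Lambda_1:\mathcal{B}_1\to\mathcal{B}_{[1]}$ the inclusion functor $(V,\mu)\mapsto(V,\mu)$, such that: 1. $\Lambda_n R_n=R_{[n]}$ for every $n\in\mathbb{N}$; 2. $U_{[n-1,n]}\Lambda_n=\Lambda_{n-1}U_{n-1,n}$ for every $n\geq 1$, and $U_{[0,n]}\Lambda_n=U_{0,n}$ for every $n\in\mathbb{N}$; 3. for every $n\in\mathbb{N}$ the natural transformation $\lambda_n:=\epsilon_{[n]}L_n\circ L_{[n]}\Lambda_n\eta_n:L_{[n]}\Lambda_n\to L_n$ is invertible, and $\lambda_1=\mathrm{Id}_{L_1}$; 4. for every $n\in\mathbb{N}$ the functor $\Lambda_n$ is fully faithful and injective on objects.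
   Context: Whiskering of a natural transformation by functors is written $F\alpha$, $\alpha G$. Coequalizers in $\mathcal{A}$ are fixed once and for all, and used in all constructions below. Adjoint decomposition of $(L,R,\eta,\epsilon)$. Define recursively categories $\mathcal{B}_{[n]}$, functors $U_{[n]}:\mathcal{B}_{[n]}\to\mathcal{B}$, adjunctions $(L_{[n]},R_{[n]},\eta_{[n]},\epsilon_{[n]})$ with $R_{[n]}:\mathcal{A}\to\mathcal{B}_{[n]}$ and $U_{[n]}R_{[n]}=R$, and natural transformations $\pi_{[n]}:LU_{[n]}\to L_{[n]}$. For $n=0$: $\mathcal{B}_{[0]}=\mathcal{B}$, $U_{[0]}=\mathrm{Id}$, $(L_{[0]},R_{[0]},\eta_{[0]},\epsilon_{[0]})=(L,R,\eta,\epsilon)$, $\pi_{[0]}=\mathrm{Id}_L$. Given stage $n$: - objects of $\mathcal{B}_{[n+1]}$ are pairs $(B_{[n]},b_{[n]})$ with $B_{[n]}\in\mathcal{B}_{[n]}$ and $b_{[n]}:RL_{[n]}B_{[n]}\to U_{[n]}B_{[n]}$ any morphism in $\mathcal{B}$; morphisms $(B_{[n]},b_{[n]})\to(B'_{[n]},b'_{[n]})$ are morphisms $f:B_{[n]}\to B'_{[n]}$ in $\mathcal{B}_{[n]}$ with $U_{[n]}f\circ b_{[n]}=b'_{[n]}\circ RL_{[n]}f$; $U_{[n,n+1]}:\mathcal{B}_{[n+1]}\to\mathcal{B}_{[n]}$ is the forgetful functor and $U_{[n+1]}=U_{[n]}U_{[n,n+1]}$; - $R_{[n+1]}A=(R_{[n]}A,R\epsilon_{[n]}A)$,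 $R_{[n+1]}f=R_{[n]}f$; - $\pi_{[n,n+1]}B_{[n+1]}:L_{[n]}B_{[n]}\to L_{[n+1]}B_{[n+1]}$ is the coequalizer of $\pi_{[n]}B_{[n]}\circ Lb_{[n]}$ and $\epsilon L_{[n]}B_{[n]}$, both from $LRL_{[n]}B_{[n]}$ to $L_{[n]}B_{[n]}$, where $B_{[n+1]}=(B_{[n]},b_{[n]})$; $\pi_{[n+1]}=\pi_{[n,n+1]}\circ\pi_{[n]}U_{[n,n+1]}$; - the unit and counit of $(L_{[n+1]},R_{[n+1]})$ are determined by $U_{[n,n+1]}\eta_{[n+1]}=R_{[n]}\pi_{[n,n+1]}\circ\eta_{[n]}U_{[n,n+1]}$ and $\epsilon_{[n+1]}\circ\pi_{[n,n+1]}R_{[n+1]}=\epsilon_{[n]}$. $U_{[m,n]}:\mathcal{B}_{[n]}\to\mathcal{B}_{[m]}$ ($m\le n$) is the composite of forgetful functors, so $U_{[0,n]}=U_{[n]}$. Monadic tower of $(L,R)$. $\mathcal{B}_0=\mathcal{B}$, $(L_0,R_0,\eta_0,\epsilon_0)=(L,R,\eta,\epsilon)$. Given $(L_n,R_n,\eta_n,\epsilon_n)$ with $R_n:\mathcal{A}\to\mathcal{B}_n$: $\mathcal{B}_{n+1}$ is the Eilenberg-Moore category of the monad $(R_nL_n,R_n\epsilon_nL_n,\eta_n)$ on $\mathcal{B}_n$, $U_{n,n+1}:\mathcal{B}_{n+1}\to\mathcal{B}_n$ is the forgetful functor, $R_{n+1}:\mathcal{A}\to\mathcal{B}_{n+1}$,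 $A\mapsto(R_nA,R_n\epsilon_nA)$, is the comparison functor, and $L_{n+1}$ is its left adjoint, with $L_{n+1}(B_n,\mu_n)$ the coequalizer of $L_n\mu_n,\epsilon_nL_nB_n:L_nR_nL_nB_n\to L_nB_n$; the unit and counit are $\eta_{n+1},\epsilon_{n+1}$. $U_{m,n}:\mathcal{B}_n\to\mathcal{B}_m$ is the composite of forgetful functors. *)

theory Defs
  imports Main
begin

section \<open>Categories, functors, natural transformations\<close>

text \<open>
  The hom-sets \<open>Hom C X Y\<close> are not assumed to be disjoint, so composition carries its three
  objects: \<open>Comp C X Y Z g f\<close> is the composite of \<open>f : X \<rightarrow> Y\<close> followed by \<open>g : Y \<rightarrow> Z\<close>.
  This allows a morphism of a category of structured objects to be literally a morphism of the
  underlying category.  For the same reason the arrow part of a functor carries source and target.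
\<close>

record ('o, 'm) category =
  Obj :: "'o set"
  Hom :: "'o \<Rightarrow> 'o \<Rightarrow> 'm set"
  Id :: "'o \<Rightarrow> 'm"
  Comp :: "'o \<Rightarrow> 'o \<Rightarrow> 'o \<Rightarrow> 'm \<Rightarrow> 'm \<Rightarrow> 'm"

definition is_category :: "('o, 'm) category \<Rightarrow> bool" where
  "is_category C \<longleftrightarrow>
     (\<forall>X\<in>Obj C. Id C X \<in> Hom C X X) \<and>
     (\<forall>X\<in>Obj C. \<forall>Y\<in>Obj C. \<forall>Z\<in>Obj C. \<forall>f\<in>Hom C X Y. \<forall>g\<in>Hom C Y Z.
        Comp C X Y Z g f \<in> Hom C X Z) \<and>
     (\<forall>X\<in>Obj C. \<forall>Y\<in>Obj C. \<forall>f\<in>Hom C X Y.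
        Comp C X X Y f (Id C X) = f \<and> Comp C X Y Y (Id C Y) f = f) \<and>
     (\<forall>X\<in>Obj C. \<forall>Y\<in>Obj C. \<forall>Z\<in>Obj C. \<forall>W\<in>Obj C.
        \<forall>f\<in>Hom C X Y. \<forall>g\<in>Hom C Y Z. \<forall>h\<in>Hom C Z W.
        Comp C X Z W h (Comp C X Y Z g f) = Comp C X Y W (Comp C Y Z W h g) f)"

record ('o, 'm, 'p, 'k) cat_functor =
  FO :: "'o \<Rightarrow> 'p"
  FA :: "'o \<Rightarrow> 'o \<Rightarrow> 'm \<Rightarrow> 'k"

definition is_functor ::
  "('o, 'm) category \<Rightarrow> ('p, 'k) category \<Rightarrow> ('o, 'm, 'p, 'k) cat_functor \<Rightarrow> bool" where
  "is_functor C D F \<longleftrightarrow> is_category C \<and> is_category D \<and>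
     (\<forall>X\<in>Obj C. FO F X \<in> Obj D) \<and>
     (\<forall>X\<in>Obj C. \<forall>Y\<in>Obj C. \<forall>f\<in>Hom C X Y. FA F X Y f \<in> Hom D (FO F X) (FO F Y)) \<and>
     (\<forall>X\<in>Obj C. FA F X X (Id C X) = Id D (FO F X)) \<and>
     (\<forall>X\<in>Obj C. \<forall>Y\<in>Obj C. \<forall>Z\<in>Obj C. \<forall>f\<in>Hom C X Y. \<forall>g\<in>Hom C Y Z.
        FA F X Z (Comp C X Y Z g f) =
        Comp D (FO F X) (FO F Y) (FO F Z) (FA F Y Z g) (FA F X Y f))"

text \<open>Equality of functors with source \<open>C\<close>; values outside of \<open>C\<close> are irrelevant.\<close>

definition functor_eq ::
  "('o, 'm) category \<Rightarrow> ('o, 'm, 'p, 'k) cat_functor \<Rightarrow> ('o, 'm, 'p, 'k) cat_functor \<Rightarrow> bool" where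
  "functor_eq C F G \<longleftrightarrow>
     (\<forall>X\<in>Obj C. FO F X = FO G X) \<and>
     (\<forall>X\<in>Obj C. \<forall>Y\<in>Obj C. \<forall>f\<in>Hom C X Y. FA F X Y f = FA G X Y f)"

definition id_functor :: "('o, 'm, 'o, 'm) cat_functor" where
  "id_functor = \<lparr>FO = (\<lambda>X. X), FA = (\<lambda>X Y f. f)\<rparr>"

definition functor_comp ::
  "('p, 'k, 'q, 'l) cat_functor \<Rightarrow> ('o, 'm, 'p, 'k) cat_functor \<Rightarrow> ('o, 'm, 'q, 'l) cat_functor"
  (infixl "\<odot>" 70) where
  "G \<odot> F = \<lparr>FO = (\<lambda>X. FO G (FO F X)), FA = (\<lambda>X Y f. FA G (FO F X) (FO F Y) (FA F X Y f))\<rparr>"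

definition fully_faithful ::
  "('o, 'm) category \<Rightarrow> ('p, 'k) category \<Rightarrow> ('o, 'm, 'p, 'k) cat_functor \<Rightarrow> bool" where
  "fully_faithful C D F \<longleftrightarrow>
     (\<forall>X\<in>Obj C. \<forall>Y\<in>Obj C. bij_betw (FA F X Y) (Hom C X Y) (Hom D (FO F X) (FO F Y)))"

definition is_nat_trans ::
  "('o, 'm) category \<Rightarrow> ('p, 'k) category \<Rightarrow> ('o, 'm, 'p, 'k) cat_functor \<Rightarrow>
   ('o, 'm, 'p, 'k) cat_functor \<Rightarrow> ('o \<Rightarrow> 'k) \<Rightarrow> bool" where
  "is_nat_trans C D F G \<alpha> \<longleftrightarrow>
     (\<forall>X\<in>Obj C. \<alpha> X \<in> Hom D (FO F X) (FO G X)) \<and>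
     (\<forall>X\<in>Obj C. \<forall>Y\<in>Obj C. \<forall>f\<in>Hom C X Y.
        Comp D (FO F X) (FO G X) (FO G Y) (FA G X Y f) (\<alpha> X) =
        Comp D (FO F X) (FO F Y) (FO G Y) (\<alpha> Y) (FA F X Y f))"

definition id_trans ::
  "('p, 'k) category \<Rightarrow> ('o, 'm, 'p, 'k) cat_functor \<Rightarrow> 'o \<Rightarrow> 'k" where
  "id_trans D F = (\<lambda>X. Id D (FO F X))"

text \<open>\<open>vcomp D F G H \<beta> \<alpha>\<close> is the vertical composite \<open>\<beta> \<circ> \<alpha>\<close> of \<open>\<alpha> : F \<rightarrow> G\<close> and \<open>\<beta> : G \<rightarrow> H\<close>, where
  \<open>D\<close> is the target category.\<close>

definition vcomp ::
  "('p, 'k) category \<Rightarrow> ('o, 'm, 'p, 'k) cat_functor \<Rightarrow> ('o, 'm, 'p, 'k) cat_functor \<Rightarrow>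
   ('o, 'm, 'p, 'k) cat_functor \<Rightarrow> ('o \<Rightarrow> 'k) \<Rightarrow> ('o \<Rightarrow> 'k) \<Rightarrow> 'o \<Rightarrow> 'k" where
  "vcomp D F G H \<beta> \<alpha> = (\<lambda>X. Comp D (FO F X) (FO G X) (FO H X) (\<beta> X) (\<alpha> X))"

text \<open>\<open>whiskerL K F G \<alpha>\<close> is \<open>K\<alpha>\<close> for \<open>\<alpha> : F \<rightarrow> G\<close>, and \<open>whiskerR \<alpha> K\<close> is \<open>\<alpha>K\<close>.\<close>

definition whiskerL ::
  "('p, 'k, 'q, 'l) cat_functor \<Rightarrow> ('o, 'm, 'p, 'k) cat_functor \<Rightarrow>
   ('o, 'm, 'p, 'k) cat_functor \<Rightarrow> ('o \<Rightarrow> 'k) \<Rightarrow> 'o \<Rightarrow> 'l" where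
  "whiskerL K F G \<alpha> = (\<lambda>X. FA K (FO F X) (FO G X) (\<alpha> X))"

definition whiskerR ::
  "('p \<Rightarrow> 'l) \<Rightarrow> ('o, 'm, 'p, 'k) cat_functor \<Rightarrow> 'o \<Rightarrow> 'l" where
  "whiskerR \<alpha> K = (\<lambda>X. \<alpha> (FO K X))"

definition is_nat_iso ::
  "('o, 'm) category \<Rightarrow> ('p, 'k) category \<Rightarrow> ('o, 'm, 'p, 'k) cat_functor \<Rightarrow>
   ('o, 'm, 'p, 'k) cat_functor \<Rightarrow> ('o \<Rightarrow> 'k) \<Rightarrow> bool" where
  "is_nat_iso C D F G \<alpha> \<longleftrightarrow> is_nat_trans C D F G \<alpha> \<and>
     (\<exists>\<beta>. is_nat_trans C D G F \<beta> \<and>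
        (\<forall>X\<in>Obj C. vcomp D F G F \<beta> \<alpha> X = id_trans D F X \<and>
                     vcomp D G F G \<alpha> \<beta> X = id_trans D G X))"

section \<open>Adjunctions and chosen coequalizers\<close>

text \<open>An adjunction between \<open>A\<close> and \<open>adj_cat S\<close>: the category \<open>A\<close>, which is the source of the
  right adjoint, stays fixed and is not part of the record.\<close>

record ('o, 'm, 'a, 'k) adjunction =
  adj_cat :: "('o, 'm) category"
  adj_L :: "('o, 'm, 'a, 'k) cat_functor"
  adj_R :: "('a, 'k, 'o, 'm) cat_functor"
  adj_unit :: "'o \<Rightarrow> 'm"
  adj_counit :: "'a \<Rightarrow> 'k"

definition is_adjunction ::
  "('a, 'k) category \<Rightarrow> ('o, 'm, 'a, 'k) adjunction \<Rightarrow> bool" where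
  "is_adjunction A S \<longleftrightarrow>
     (let B = adj_cat S; L = adj_L S; R = adj_R S; \<eta> = adj_unit S; \<epsilon> = adj_counit S in
      is_functor B A L \<and> is_functor A B R \<and>
      is_nat_trans B B id_functor (R \<odot> L) \<eta> \<and>
      is_nat_trans A A (L \<odot> R) id_functor \<epsilon> \<and>
      (\<forall>X\<in>Obj B. vcomp A L (L \<odot> R \<odot> L) L (whiskerR \<epsilon> L) (whiskerL L id_functor (R \<odot> L) \<eta>) X
                    = id_trans A L X) \<and>
      (\<forall>X\<in>Obj A. vcomp B R (R \<odot> L \<odot> R) R (whiskerL R (L \<odot> R) id_functor \<epsilon>) (whiskerR \<eta> R) X
                    = id_trans B R X))"

definition is_coequalizer ::
  "('a, 'k) category \<Rightarrow> 'a \<Rightarrow> 'a \<Rightarrow> 'k \<Rightarrow> 'k \<Rightarrow> 'a \<Rightarrow> 'k \<Rightarrow> bool" where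
  "is_coequalizer A X Y f g Q q \<longleftrightarrow>
     Q \<in> Obj A \<and> q \<in> Hom A Y Q \<and> Comp A X Y Q q f = Comp A X Y Q q g \<and>
     (\<forall>Z\<in>Obj A. \<forall>h\<in>Hom A Y Z. Comp A X Y Z h f = Comp A X Y Z h g \<longrightarrow>
        (\<exists>!u. u \<in> Hom A Q Z \<and> Comp A Y Q Z u q = h))"

text \<open>A choice of coequalizers assigns to a pair \<open>f, g : X \<rightarrow> Y\<close> a pair \<open>(Q, q)\<close>.\<close>

type_synonym ('a, 'k) coequalizers = "'a \<Rightarrow> 'a \<Rightarrow> 'k \<Rightarrow> 'k \<Rightarrow> 'a \<times> 'k"

definition coequalizer_choice :: "('a, 'k) category \<Rightarrow> ('a, 'k) coequalizers \<Rightarrow> bool" where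
  "coequalizer_choice A cq \<longleftrightarrow>
     (\<forall>X\<in>Obj A. \<forall>Y\<in>Obj A. \<forall>f\<in>Hom A X Y. \<forall>g\<in>Hom A X Y.
        is_coequalizer A X Y f g (fst (cq X Y f g)) (snd (cq X Y f g)))"

text \<open>The pointwise (chosen) coequalizer of natural transformations \<open>\<alpha>, \<beta> : F \<rightarrow> G\<close>, with the
  unique functor structure for which the projection \<open>G \<rightarrow> coeq_functor A cq F G \<alpha> \<beta>\<close> is natural.\<close>

definition coeq_proj ::
  "('a, 'k) coequalizers \<Rightarrow> ('o, 'm, 'a, 'k) cat_functor \<Rightarrow> ('o, 'm, 'a, 'k) cat_functor \<Rightarrow>
   ('o \<Rightarrow> 'k) \<Rightarrow> ('o \<Rightarrow> 'k) \<Rightarrow> 'o \<Rightarrow> 'k" where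
  "coeq_proj cq F G \<alpha> \<beta> = (\<lambda>X. snd (cq (FO F X) (FO G X) (\<alpha> X) (\<beta> X)))"

definition coeq_functor ::
  "('a, 'k) category \<Rightarrow> ('a, 'k) coequalizers \<Rightarrow> ('o, 'm, 'a, 'k) cat_functor \<Rightarrow>
   ('o, 'm, 'a, 'k) cat_functor \<Rightarrow> ('o \<Rightarrow> 'k) \<Rightarrow> ('o \<Rightarrow> 'k) \<Rightarrow> ('o, 'm, 'a, 'k) cat_functor" where
  "coeq_functor A cq F G \<alpha> \<beta> =
     (let Q = (\<lambda>X. fst (cq (FO F X) (FO G X) (\<alpha> X) (\<beta> X)));
          q = coeq_proj cq F G \<alpha> \<beta>
      in \<lparr>FO = Q,
          FA = (\<lambda>X Y f. THE u. u \<in> Hom A (Q X) (Q Y) \<and>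
                  Comp A (FO G X) (Q X) (Q Y) u (q X) =
                  Comp A (FO G X) (FO G Y) (Q Y) (q Y) (FA G X Y f))\<rparr>)"

section \<open>Iterated structured objects\<close>

text \<open>
  All stages of both towers need a common type of objects.  \<open>Base X\<close> is an object \<open>X\<close> of the
  category \<open>\<B>\<close>, \<open>Ext X b\<close> is the pair \<open>(X, b)\<close>.  As morphisms at every stage are morphisms of
  \<open>\<B>\<close> subject to conditions, the type of morphisms never changes.
\<close>

datatype ('b, 'm) tower_obj =
    Base (unbase: 'b)
  | Ext (underlying: "('b, 'm) tower_obj") (action: 'm)

text \<open>The given adjunction, with \<open>\<B>\<close> replaced by its copy along \<open>Base\<close>; this is stage 0 of both
  towers.\<close>

definition base_adjunction ::
  "('b, 'm, 'a, 'k) adjunction \<Rightarrow> (('b, 'm) tower_obj, 'm, 'a, 'k) adjunction" where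
  "base_adjunction S =
     (let B = adj_cat S; L = adj_L S; R = adj_R S in
      \<lparr>adj_cat =
         \<lparr>Obj = Base ` Obj B,
          Hom = (\<lambda>X Y. Hom B (unbase X) (unbase Y)),
          Id = (\<lambda>X. Id B (unbase X)),
          Comp = (\<lambda>X Y Z. Comp B (unbase X) (unbase Y) (unbase Z))\<rparr>,
       adj_L = \<lparr>FO = (\<lambda>X. FO L (unbase X)), FA = (\<lambda>X Y. FA L (unbase X) (unbase Y))\<rparr>,
       adj_R = \<lparr>FO = (\<lambda>Z. Base (FO R Z)), FA = FA R\<rparr>,
       adj_unit = (\<lambda>X. adj_unit S (unbase X)),
       adj_counit = adj_counit S\<rparr>)"

definition forget :: "(('b, 'm) tower_obj, 'm, ('b, 'm) tower_obj, 'm) cat_functor" where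
  "forget = \<lparr>FO = underlying, FA = (\<lambda>X Y f. f)\<rparr>"

text \<open>The composite of forgetful functors from stage \<open>n\<close> to stage \<open>m\<close>, for \<open>m \<le> n\<close>.  As a map
  it is the same for both towers: it strips \<open>n - m\<close> layers.\<close>

primrec forget_iter ::
  "nat \<Rightarrow> (('b, 'm) tower_obj, 'm, ('b, 'm) tower_obj, 'm) cat_functor" where
  "forget_iter 0 = id_functor"
| "forget_iter (Suc k) = forget_iter k \<odot> forget"

definition forget_to ::
  "nat \<Rightarrow> nat \<Rightarrow> (('b, 'm) tower_obj, 'm, ('b, 'm) tower_obj, 'm) cat_functor" where
  "forget_to m n = forget_iter (n - m)"

text \<open>The functor \<open>Z \<mapsto> (R Z, \<rho> Z)\<close>, acting on morphisms as \<open>R\<close>.\<close>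

definition comparison ::
  "('a, 'k, ('b, 'm) tower_obj, 'm) cat_functor \<Rightarrow> ('a \<Rightarrow> 'm) \<Rightarrow>
   ('a, 'k, ('b, 'm) tower_obj, 'm) cat_functor" where
  "comparison R \<rho> = \<lparr>FO = (\<lambda>Z. Ext (FO R Z) (\<rho> Z)), FA = FA R\<rparr>"

text \<open>
  Both towers obtain stage \<open>n + 1\<close> from stage \<open>n\<close> in the same way, once the category \<open>C'\<close>
  of stage \<open>n + 1\<close>, the right adjoint \<open>R'\<close>, the left adjoint \<open>L'\<close> and the projection
  \<open>q : L U \<rightarrow> L'\<close> are known, \<open>U\<close> being the forgetful functor.  The unit \<open>\<eta>'\<close> and counit \<open>\<epsilon>'\<close> are
  determined by \<open>U \<eta>' = R q \<circ> \<eta> U\<close> and \<open>\<epsilon>' \<circ> q R' = \<epsilon>\<close>.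
\<close>

definition next_adjunction ::
  "('a, 'k) category \<Rightarrow> (('b, 'm) tower_obj, 'm, 'a, 'k) adjunction \<Rightarrow>
   (('b, 'm) tower_obj, 'm) category \<Rightarrow> ('a, 'k, ('b, 'm) tower_obj, 'm) cat_functor \<Rightarrow>
   (('b, 'm) tower_obj, 'm, 'a, 'k) cat_functor \<Rightarrow> (('b, 'm) tower_obj \<Rightarrow> 'k) \<Rightarrow>
   (('b, 'm) tower_obj, 'm, 'a, 'k) adjunction" where
  "next_adjunction A S C' R' L' q =
     (let C = adj_cat S; L = adj_L S; R = adj_R S; \<eta> = adj_unit S; \<epsilon> = adj_counit S in
      \<lparr>adj_cat = C', adj_L = L', adj_R = R',
       adj_unit = vcomp C forget (R \<odot> L \<odot> forget) (R \<odot> L')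
                    (whiskerL R (L \<odot> forget) L' q) (whiskerR \<eta> forget),
       adj_counit = (\<lambda>Z. THE e. e \<in> Hom A (FO (L' \<odot> R') Z) Z \<and>
                      Comp A (FO (L \<odot> R) Z) (FO (L' \<odot> R') Z) Z e (whiskerR q R' Z) = \<epsilon> Z)\<rparr>)"

section \<open>The monadic tower\<close>

definition em_category ::
  "(('b, 'm) tower_obj, 'm) category \<Rightarrow>
   (('b, 'm) tower_obj, 'm, ('b, 'm) tower_obj, 'm) cat_functor \<Rightarrow>
   (('b, 'm) tower_obj \<Rightarrow> 'm) \<Rightarrow> (('b, 'm) tower_obj \<Rightarrow> 'm) \<Rightarrow>
   (('b, 'm) tower_obj, 'm) category" where
  "em_category C T mult \<eta> =
     \<lparr>Obj = {Ext V \<mu> |V \<mu>. V \<in> Obj C \<and> \<mu> \<in> Hom C (FO T V) V \<and>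
               Comp C V (FO T V) V \<mu> (\<eta> V) = Id C V \<and>
               Comp C (FO (T \<odot> T) V) (FO T V) V \<mu> (FA T (FO T V) V \<mu>) =
               Comp C (FO (T \<odot> T) V) (FO T V) V \<mu> (mult V)},
      Hom = (\<lambda>P P'. {f \<in> Hom C (underlying P) (underlying P').
               Comp C (FO T (underlying P)) (underlying P) (underlying P') f (action P) =
               Comp C (FO T (underlying P)) (FO T (underlying P')) (underlying P') (action P')
                 (FA T (underlying P) (underlying P') f)}),
      Id = (\<lambda>P. Id C (underlying P)),
      Comp = (\<lambda>P P' P''. Comp C (underlying P) (underlying P') (underlying P''))\<rparr>"

definition monadic_step ::
  "('a, 'k) category \<Rightarrow> ('a, 'k) coequalizers \<Rightarrow>
   (('b, 'm) tower_obj, 'm, 'a, 'k) adjunction \<Rightarrow> (('b, 'm) tower_obj, 'm, 'a, 'k) adjunction" where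
  "monadic_step A cq S =
     (let C = adj_cat S; L = adj_L S; R = adj_R S; \<eta> = adj_unit S; \<epsilon> = adj_counit S;
          R\<epsilon> = whiskerL R (L \<odot> R) id_functor \<epsilon>;
          C' = em_category C (R \<odot> L) (whiskerR R\<epsilon> L) \<eta>;
          F = L \<odot> R \<odot> L \<odot> forget;
          G = L \<odot> forget;
          \<alpha> = whiskerL L (R \<odot> L \<odot> forget) forget action;
          \<beta> = whiskerR \<epsilon> (L \<odot> forget)
      in next_adjunction A S C' (comparison R R\<epsilon>) (coeq_functor A cq F G \<alpha> \<beta>)
           (coeq_proj cq F G \<alpha> \<beta>))"

primrec monadic_tower ::
  "('a, 'k) category \<Rightarrow> ('a, 'k) coequalizers \<Rightarrow> ('b, 'm, 'a, 'k) adjunction \<Rightarrow> nat \<Rightarrow>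
   (('b, 'm) tower_obj, 'm, 'a, 'k) adjunction" where
  "monadic_tower A cq S 0 = base_adjunction S"
| "monadic_tower A cq S (Suc n) = monadic_step A cq (monadic_tower A cq S n)"

section \<open>The adjoint decomposition\<close>

text \<open>\<open>structured_category B C T U\<close> has as objects the pairs \<open>(X, b)\<close> with \<open>X\<close> in \<open>C\<close> and
  \<open>b : T X \<rightarrow> U X\<close> any morphism of \<open>B\<close>, for functors \<open>T, U : C \<rightarrow> B\<close>.\<close>

definition structured_category ::
  "(('b, 'm) tower_obj, 'm) category \<Rightarrow> (('b, 'm) tower_obj, 'm) category \<Rightarrow>
   (('b, 'm) tower_obj, 'm, ('b, 'm) tower_obj, 'm) cat_functor \<Rightarrow>
   (('b, 'm) tower_obj, 'm, ('b, 'm) tower_obj, 'm) cat_functor \<Rightarrow>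
   (('b, 'm) tower_obj, 'm) category" where
  "structured_category B C T U =
     \<lparr>Obj = {Ext X b |X b. X \<in> Obj C \<and> b \<in> Hom B (FO T X) (FO U X)},
      Hom = (\<lambda>P P'. {f \<in> Hom C (underlying P) (underlying P').
               Comp B (FO T (underlying P)) (FO U (underlying P)) (FO U (underlying P'))
                 (FA U (underlying P) (underlying P') f) (action P) =
               Comp B (FO T (underlying P)) (FO T (underlying P')) (FO U (underlying P'))
                 (action P') (FA T (underlying P) (underlying P') f)}),
      Id = (\<lambda>P. Id C (underlying P)),
      Comp = (\<lambda>P P' P''. Comp C (underlying P) (underlying P') (underlying P''))\<rparr>"

text \<open>A stage of the decomposition consists of the adjunction and of \<open>\<pi> : L U \<rightarrow> L\<^sub>n\<close>, where
  \<open>S0\<close> is stage 0 and \<open>U\<close> is the forgetful functor from stage \<open>n\<close> to stage 0.\<close>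

definition decomposition_step ::
  "('a, 'k) category \<Rightarrow> ('a, 'k) coequalizers \<Rightarrow>
   (('b, 'm) tower_obj, 'm, 'a, 'k) adjunction \<Rightarrow> nat \<Rightarrow>
   (('b, 'm) tower_obj, 'm, 'a, 'k) adjunction \<times> (('b, 'm) tower_obj \<Rightarrow> 'k) \<Rightarrow>
   (('b, 'm) tower_obj, 'm, 'a, 'k) adjunction \<times> (('b, 'm) tower_obj \<Rightarrow> 'k)" where
  "decomposition_step A cq S0 n Sn =
     (let B = adj_cat S0; L = adj_L S0; R = adj_R S0; \<epsilon> = adj_counit S0; U = forget_to 0 n;
          C = adj_cat (fst Sn); Ln = adj_L (fst Sn); Rn = adj_R (fst Sn);
          \<epsilon>n = adj_counit (fst Sn); \<pi> = snd Sn;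
          C' = structured_category B C (R \<odot> Ln) U;
          F = L \<odot> R \<odot> Ln \<odot> forget;
          G = Ln \<odot> forget;
          \<alpha> = vcomp A F (L \<odot> U \<odot> forget) G (whiskerR \<pi> forget)
                (whiskerL L (R \<odot> Ln \<odot> forget) (U \<odot> forget) action);
          \<beta> = whiskerR \<epsilon> (Ln \<odot> forget);
          L' = coeq_functor A cq F G \<alpha> \<beta>;
          q = coeq_proj cq F G \<alpha> \<beta>
      in (next_adjunction A (fst Sn) C' (comparison Rn (whiskerL R (Ln \<odot> Rn) id_functor \<epsilon>n)) L' q,
          vcomp A (L \<odot> U \<odot> forget) G L' q (whiskerR \<pi> forget)))"

primrec decomposition_stage ::
  "('a, 'k) category \<Rightarrow> ('a, 'k) coequalizers \<Rightarrow> ('b, 'm, 'a, 'k) adjunction \<Rightarrow> nat \<Rightarrow>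
   (('b, 'm) tower_obj, 'm, 'a, 'k) adjunction \<times> (('b, 'm) tower_obj \<Rightarrow> 'k)" where
  "decomposition_stage A cq S 0 =
     (base_adjunction S, id_trans A (adj_L (base_adjunction S)))"
| "decomposition_stage A cq S (Suc n) =
     decomposition_step A cq (base_adjunction S) n (decomposition_stage A cq S n)"

definition adjoint_decomposition ::
  "('a, 'k) category \<Rightarrow> ('a, 'k) coequalizers \<Rightarrow> ('b, 'm, 'a, 'k) adjunction \<Rightarrow> nat \<Rightarrow>
   (('b, 'm) tower_obj, 'm, 'a, 'k) adjunction" where
  "adjoint_decomposition A cq S n = fst (decomposition_stage A cq S n)"

section \<open>The comparison of the two towers\<close>

text \<open>For adjunctions \<open>S = (L, R, \<eta>, \<epsilon>)\<close> and \<open>S' = (L', R', \<eta>', \<epsilon>')\<close> and a functor \<open>\<Lambda>\<close> with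
  \<open>\<Lambda> R = R'\<close>, the transformation \<open>\<epsilon>' L \<circ> L' \<Lambda> \<eta> : L' \<Lambda> \<rightarrow> L\<close>.\<close>

definition mate ::
  "('a, 'k) category \<Rightarrow> ('o, 'm, 'a, 'k) adjunction \<Rightarrow> ('p, 'l, 'a, 'k) adjunction \<Rightarrow>
   ('o, 'm, 'p, 'l) cat_functor \<Rightarrow> 'o \<Rightarrow> 'k" where
  "mate A S S' \<Lambda> =
     vcomp A (adj_L S' \<odot> \<Lambda>) (adj_L S' \<odot> adj_R S' \<odot> adj_L S) (adj_L S)
       (whiskerR (adj_counit S') (adj_L S))
       (whiskerL (adj_L S' \<odot> \<Lambda>) id_functor (adj_R S \<odot> adj_L S) (adj_unit S))"

end

theory Submission
  imports Defs
begin

text \<open>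
  The embedding is built by recursion: \<open>\<Lambda>\<^bsub>n+1\<^esub> (X, \<mu>) = (\<Lambda>\<^sub>n X, \<mu> \<circ> R (\<lambda>\<^sub>n X))\<close>, where the
  composite is formed in \<open>\<B>\<close>, and \<open>\<Lambda>\<^sub>n\<close> acts identically on morphisms, because at every stage of
  either tower a morphism is a morphism of \<open>\<B>\<close> satisfying conditions.

  The invertibility of \<open>\<lambda>\<^sub>n\<close> needs no analysis of coequalizers.  If \<open>\<Lambda>\<close> is fully faithful and
  \<open>\<Lambda> R = R'\<close>, then
  \<open>Hom (L' \<Lambda> X, Z) = Hom (\<Lambda> X, R' Z) = Hom (\<Lambda> X, \<Lambda> R Z) = Hom (X, R Z) = Hom (L X, Z)\<close>,
  and the isomorphism this yields by the Yoneda lemma is the mate (\<open>lam_nat_iso\<close>).  So the induction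
  only has to carry full faithfulness, injectivity on objects and \<open>\<Lambda>\<^sub>n R\<^sub>n = R\<^bsub>[n]\<^esub>\<close>
  (\<open>stage_embedding_step\<close>).  The first two pass to stage \<open>n + 1\<close> because \<open>R \<lambda>\<^sub>n\<close> can be cancelled on the
  right: a morphism of \<open>\<B>\<^sub>n\<close> commutes with \<open>\<mu>, \<mu>'\<close> iff it commutes with \<open>\<mu> \<circ> R \<lambda>\<^sub>n, \<mu>' \<circ> R \<lambda>\<^sub>n\<close>, and
  \<open>\<mu> \<circ> R \<lambda>\<^sub>n\<close> determines \<open>\<mu>\<close>.  The third passes on because \<open>\<epsilon>\<^sub>n \<circ> \<lambda>\<^sub>n R\<^sub>n = \<epsilon>\<^bsub>[n]\<^esub>\<close> (\<open>counit_lam\<close>).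

  This presupposes that both towers consist of adjunctions.  Both inductive steps are instances of
  one criterion (\<open>next_is_adjunction\<close>): if \<open>h : L X \<rightarrow> Z\<close> coequalizes the chosen pair exactly when its
  transpose \<open>X \<rightarrow> R Z\<close> is a morphism of the new category, then the coequalizer is left adjoint to the
  new right adjoint.  For the decomposition the criterion rests on the identity
  \<open>U\<^bsub>[n]\<^esub> \<eta>\<^bsub>[n]\<^esub> = R \<pi>\<^bsub>[n]\<^esub> \<circ> \<eta> U\<^bsub>[n]\<^esub>\<close>, which is carried along the tower (locale \<open>lies_over\<close>).

  At stage 0 the mate is an identity, so at stage 1 both towers take the chosen coequalizer of
  literally the same pair; hence \<open>L\<^bsub>[1]\<^esub> \<Lambda>\<^sub>1 = L\<^sub>1\<close> and \<open>\<lambda>\<^sub>1\<close> is one side of a triangle identity.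
\<close>

section \<open>Categories and functors\<close>

lemma cat_id: "is_category C \<Longrightarrow> X \<in> Obj C \<Longrightarrow> Id C X \<in> Hom C X X"
  by (simp add: is_category_def)

lemma cat_comp:
  "is_category C \<Longrightarrow> f \<in> Hom C X Y \<Longrightarrow> g \<in> Hom C Y Z \<Longrightarrow>
   X \<in> Obj C \<Longrightarrow> Y \<in> Obj C \<Longrightarrow> Z \<in> Obj C \<Longrightarrow> Comp C X Y Z g f \<in> Hom C X Z"
  by (simp add: is_category_def)

lemma cat_id_right:
  "is_category C \<Longrightarrow> f \<in> Hom C X Y \<Longrightarrow> X \<in> Obj C \<Longrightarrow> Y \<in> Obj C \<Longrightarrow> Comp C X X Y f (Id C X) = f"
  by (simp add: is_category_def)

lemma cat_id_left:
  "is_category C \<Longrightarrow> f \<in> Hom C X Y \<Longrightarrow> X \<in> Obj C \<Longrightarrow> Y \<in> Obj C \<Longrightarrow> Comp C X Y Y (Id C Y) f = f"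
  by (simp add: is_category_def)

lemma cat_assoc:
  "is_category C \<Longrightarrow> f \<in> Hom C X Y \<Longrightarrow> g \<in> Hom C Y Z \<Longrightarrow> h \<in> Hom C Z W \<Longrightarrow>
   X \<in> Obj C \<Longrightarrow> Y \<in> Obj C \<Longrightarrow> Z \<in> Obj C \<Longrightarrow> W \<in> Obj C \<Longrightarrow>
   Comp C X Y W (Comp C Y Z W h g) f = Comp C X Z W h (Comp C X Y Z g f)"
  by (simp add: is_category_def)

lemmas cat_simps = cat_id cat_comp cat_id_right cat_id_left cat_assoc

lemma fun_source: "is_functor C D F \<Longrightarrow> is_category C"
  and fun_target: "is_functor C D F \<Longrightarrow> is_category D"
  and fun_obj: "is_functor C D F \<Longrightarrow> X \<in> Obj C \<Longrightarrow> FO F X \<in> Obj D"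
  and fun_hom: "is_functor C D F \<Longrightarrow> f \<in> Hom C X Y \<Longrightarrow> X \<in> Obj C \<Longrightarrow> Y \<in> Obj C \<Longrightarrow>
    FA F X Y f \<in> Hom D (FO F X) (FO F Y)"
  and fun_id: "is_functor C D F \<Longrightarrow> X \<in> Obj C \<Longrightarrow> FA F X X (Id C X) = Id D (FO F X)"
  and fun_comp: "is_functor C D F \<Longrightarrow> f \<in> Hom C X Y \<Longrightarrow> g \<in> Hom C Y Z \<Longrightarrow>
    X \<in> Obj C \<Longrightarrow> Y \<in> Obj C \<Longrightarrow> Z \<in> Obj C \<Longrightarrow>
    FA F X Z (Comp C X Y Z g f) = Comp D (FO F X) (FO F Y) (FO F Z) (FA F Y Z g) (FA F X Y f)"
  by (simp_all add: is_functor_def)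

lemma functor_comp_simps [simp]:
  "FO (G \<odot> F) X = FO G (FO F X)"
  "FA (G \<odot> F) X Y f = FA G (FO F X) (FO F Y) (FA F X Y f)"
  by (simp_all add: functor_comp_def)

lemma id_functor_simps [simp]: "FO id_functor X = X" "FA id_functor X Y f = f"
  by (simp_all add: id_functor_def)

lemma forget_simps [simp]: "FO forget X = underlying X" "FA forget X Y f = f"
  by (simp_all add: forget_def)

lemma comparison_simps [simp]:
  "FO (comparison R \<rho>) Z = Ext (FO R Z) (\<rho> Z)" "FA (comparison R \<rho>) = FA R"
  by (simp_all add: comparison_def)

lemma FA_forget_iter [simp]: "FA (forget_iter n) X Y f = f"
  by (induction n arbitrary: X Y) simp_all

lemma FA_forget_to [simp]: "FA (forget_to m n) X Y f = f"
  by (simp add: forget_to_def)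

lemma id_is_functor: "is_category C \<Longrightarrow> is_functor C C id_functor"
  by (simp add: is_functor_def)

lemma comp_is_functor:
  assumes "is_functor C D F" and "is_functor D E G"
  shows "is_functor C E (G \<odot> F)"
  using assms unfolding is_functor_def by simp

lemma nat_hom: "is_nat_trans C D F G \<alpha> \<Longrightarrow> X \<in> Obj C \<Longrightarrow> \<alpha> X \<in> Hom D (FO F X) (FO G X)"
  and nat_square: "is_nat_trans C D F G \<alpha> \<Longrightarrow> f \<in> Hom C X Y \<Longrightarrow> X \<in> Obj C \<Longrightarrow> Y \<in> Obj C \<Longrightarrow>
    Comp D (FO F X) (FO F Y) (FO G Y) (\<alpha> Y) (FA F X Y f) =
    Comp D (FO F X) (FO G X) (FO G Y) (FA G X Y f) (\<alpha> X)"
  by (simp_all add: is_nat_trans_def)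

lemma nat_iso_if_components_invertible:
  assumes F: "is_functor C D F" and G: "is_functor C D G" and \<alpha>: "is_nat_trans C D F G \<alpha>"
    and inv: "\<And>X. X \<in> Obj C \<Longrightarrow> \<exists>b\<in>Hom D (FO G X) (FO F X).
        Comp D (FO F X) (FO G X) (FO F X) b (\<alpha> X) = Id D (FO F X) \<and>
        Comp D (FO G X) (FO F X) (FO G X) (\<alpha> X) b = Id D (FO G X)"
  shows "is_nat_iso C D F G \<alpha>"
proof -
  note D = fun_target[OF F]
  obtain \<beta> where \<beta>: "\<beta> X \<in> Hom D (FO G X) (FO F X)"
      "Comp D (FO F X) (FO G X) (FO F X) (\<beta> X) (\<alpha> X) = Id D (FO F X)"
      "Comp D (FO G X) (FO F X) (FO G X) (\<alpha> X) (\<beta> X) = Id D (FO G X)" if "X \<in> Obj C" for X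
    using inv by metis
  have "is_nat_trans C D G F \<beta>"
    unfolding is_nat_trans_def
  proof (intro conjI ballI)
    fix X Y f assume X: "X \<in> Obj C" and Y: "Y \<in> Obj C" and f: "f \<in> Hom C X Y"
    let ?F = "FO F X" and ?F' = "FO F Y" and ?G = "FO G X" and ?G' = "FO G Y"
    note mem = fun_obj[OF F X] fun_obj[OF F Y] fun_obj[OF G X] fun_obj[OF G Y]
      fun_hom[OF F f X Y] fun_hom[OF G f X Y] nat_hom[OF \<alpha> X] nat_hom[OF \<alpha> Y] \<beta>(1)[OF X] \<beta>(1)[OF Y]
    have "Comp D ?G ?F ?F' (FA F X Y f) (\<beta> X) =
        Comp D ?G ?F ?F' (Comp D ?F ?F' ?F' (Comp D ?F' ?G' ?F' (\<beta> Y) (\<alpha> Y)) (FA F X Y f)) (\<beta> X)"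
      using mem D by (simp add: \<beta>(2)[OF Y] cat_simps)
    also have "\<dots> = Comp D ?G ?F ?F'
        (Comp D ?F ?G' ?F' (\<beta> Y) (Comp D ?F ?F' ?G' (\<alpha> Y) (FA F X Y f))) (\<beta> X)"
      using mem D by (simp add: cat_simps)
    also have "\<dots> = Comp D ?G ?G' ?F' (\<beta> Y) (Comp D ?G ?G ?G' (FA G X Y f) (Comp D ?G ?F ?G (\<alpha> X) (\<beta> X)))"
      using mem D by (simp only: nat_square[OF \<alpha> f X Y]) (simp add: cat_simps)
    also have "\<dots> = Comp D ?G ?G' ?F' (\<beta> Y) (FA G X Y f)"
      using mem D by (simp add: \<beta>(3)[OF X] cat_simps)
    finally show "Comp D ?G ?F ?F' (FA F X Y f) (\<beta> X) = Comp D ?G ?G' ?F' (\<beta> Y) (FA G X Y f)" .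
  qed (fact \<beta>(1))
  then show ?thesis
    using \<alpha> \<beta> by (auto simp: is_nat_iso_def vcomp_def id_trans_def)
qed

section \<open>Adjunctions and transposition\<close>

text \<open>Equations between morphisms out of \<open>L X\<close> are mostly proved by computing the transposes of both
  sides, which suffices by \<open>transpose_inject\<close>.\<close>

locale adjoint_pair =
  fixes A :: "('a, 'k) category" and S :: "('o, 'm, 'a, 'k) adjunction"
  assumes adj: "is_adjunction A S"
begin

abbreviation "C \<equiv> adj_cat S"
abbreviation "Lo \<equiv> FO (adj_L S)"
abbreviation "La \<equiv> FA (adj_L S)"
abbreviation "Ro \<equiv> FO (adj_R S)"
abbreviation "Ra \<equiv> FA (adj_R S)"
abbreviation "unit \<equiv> adj_unit S"
abbreviation "counit \<equiv> adj_counit S"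

lemma L_functor: "is_functor C A (adj_L S)" and R_functor: "is_functor A C (adj_R S)"
  and unit_nat: "is_nat_trans C C id_functor (adj_R S \<odot> adj_L S) unit"
  and counit_nat: "is_nat_trans A A (adj_L S \<odot> adj_R S) id_functor counit"
  using adj by (simp_all add: is_adjunction_def Let_def)

lemma cats: "is_category A" "is_category C"
  using fun_source[OF L_functor] fun_target[OF L_functor] by simp_all

lemma unit_hom: "X \<in> Obj C \<Longrightarrow> unit X \<in> Hom C X (Ro (Lo X))"
  using nat_hom[OF unit_nat] by simp

lemma counit_hom: "Z \<in> Obj A \<Longrightarrow> counit Z \<in> Hom A (Lo (Ro Z)) Z"
  using nat_hom[OF counit_nat] by simp

lemma unit_square:
  "f \<in> Hom C X Y \<Longrightarrow> X \<in> Obj C \<Longrightarrow> Y \<in> Obj C \<Longrightarrow>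
   Comp C X Y (Ro (Lo Y)) (unit Y) f =
   Comp C X (Ro (Lo X)) (Ro (Lo Y)) (Ra (Lo X) (Lo Y) (La X Y f)) (unit X)"
  using nat_square[OF unit_nat] by simp

lemma counit_square:
  "f \<in> Hom A X Y \<Longrightarrow> X \<in> Obj A \<Longrightarrow> Y \<in> Obj A \<Longrightarrow>
   Comp A (Lo (Ro X)) (Lo (Ro Y)) Y (counit Y) (La (Ro X) (Ro Y) (Ra X Y f)) =
   Comp A (Lo (Ro X)) X Y f (counit X)"
  using nat_square[OF counit_nat] by simp

lemma triangle_L:
  "X \<in> Obj C \<Longrightarrow>
   Comp A (Lo X) (Lo (Ro (Lo X))) (Lo X) (counit (Lo X)) (La X (Ro (Lo X)) (unit X)) = Id A (Lo X)"
  and triangle_R: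
  "Z \<in> Obj A \<Longrightarrow>
   Comp C (Ro Z) (Ro (Lo (Ro Z))) (Ro Z) (Ra (Lo (Ro Z)) Z (counit Z)) (unit (Ro Z)) = Id C (Ro Z)"
  using adj by (simp_all add: is_adjunction_def Let_def vcomp_def whiskerL_def whiskerR_def id_trans_def)

lemmas mem_simps = cats fun_obj[OF L_functor] fun_obj[OF R_functor] fun_hom[OF L_functor]
  fun_hom[OF R_functor] unit_hom counit_hom cat_comp cat_id

lemmas comp_simps = fun_comp[OF L_functor] fun_comp[OF R_functor] fun_id[OF L_functor]
  fun_id[OF R_functor] cat_id_left cat_id_right

definition transpose :: "'o \<Rightarrow> 'a \<Rightarrow> 'k \<Rightarrow> 'm" where
  "transpose X Z h = Comp C X (Ro (Lo X)) (Ro Z) (Ra (Lo X) Z h) (unit X)"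

context
  fixes X Z h assumes X: "X \<in> Obj C" and Z: "Z \<in> Obj A" and h: "h \<in> Hom A (Lo X) Z"
begin

lemma transpose_hom: "transpose X Z h \<in> Hom C X (Ro Z)"
  using X Z h by (simp add: transpose_def mem_simps)

lemma untranspose:
  "Comp A (Lo X) (Lo (Ro Z)) Z (counit Z) (La X (Ro Z) (transpose X Z h)) = h"
proof -
  have "Comp A (Lo X) (Lo (Ro Z)) Z (counit Z) (La X (Ro Z) (transpose X Z h)) =
      Comp A (Lo X) (Lo (Ro (Lo X))) Z
        (Comp A (Lo (Ro (Lo X))) (Lo (Ro Z)) Z (counit Z)
          (La (Ro (Lo X)) (Ro Z) (Ra (Lo X) Z h)))
        (La X (Ro (Lo X)) (unit X))"
    using X Z h by (simp add: transpose_def mem_simps comp_simps cat_assoc)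
  also have "\<dots> = Comp A (Lo X) (Lo X) Z h
      (Comp A (Lo X) (Lo (Ro (Lo X))) (Lo X) (counit (Lo X)) (La X (Ro (Lo X)) (unit X)))"
    using X Z h by (simp add: counit_square mem_simps cat_assoc)
  also have "\<dots> = h"
    using X Z h by (simp add: triangle_L mem_simps comp_simps)
  finally show ?thesis .
qed

text \<open>\<open>R h\<close> is what commuting with the structure \<open>R \<epsilon>\<close> of the objects \<open>R Z\<close> produces; this turns
  "the transpose of \<open>h\<close> is a morphism of structured objects" into a condition on \<open>R h\<close>.\<close>

lemma R_untranspose:
  "Comp C (Ro (Lo X)) (Ro (Lo (Ro Z))) (Ro Z) (Ra (Lo (Ro Z)) Z (counit Z))
     (Ra (Lo X) (Lo (Ro Z)) (La X (Ro Z) (transpose X Z h))) = Ra (Lo X) Z h"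
proof -
  have "Ra (Lo X) Z (Comp A (Lo X) (Lo (Ro Z)) Z (counit Z) (La X (Ro Z) (transpose X Z h))) =
      Ra (Lo X) Z h"
    by (simp add: untranspose)
  then show ?thesis
    using X Z transpose_hom by (simp add: mem_simps comp_simps)
qed

lemma transpose_precomp:
  assumes W: "W \<in> Obj C" and f: "f \<in> Hom C W X"
  shows "transpose W Z (Comp A (Lo W) (Lo X) Z h (La W X f)) = Comp C W X (Ro Z) (transpose X Z h) f"
  using X Z h assms by (simp add: transpose_def mem_simps comp_simps cat_assoc unit_square)

end

lemma transpose_inject:
  assumes "X \<in> Obj C" "Z \<in> Obj A" "h \<in> Hom A (Lo X) Z" "h' \<in> Hom A (Lo X) Z"
  shows "transpose X Z h = transpose X Z h' \<longleftrightarrow> h = h'"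
  using assms by (metis untranspose)

lemma transpose_counit:
  assumes "Y \<in> Obj A" "Z \<in> Obj A" "h \<in> Hom A Y Z"
  shows "transpose (Ro Y) Z (Comp A (Lo (Ro Y)) Y Z h (counit Y)) = Ra Y Z h"
  using assms by (simp add: transpose_def mem_simps comp_simps cat_assoc triangle_R)

end

section \<open>Coequalizers of natural transformations\<close>

locale coequalizer_functor =
  fixes A :: "('a, 'k) category" and cq :: "('a, 'k) coequalizers" and C :: "('o, 'm) category"
    and F G :: "('o, 'm, 'a, 'k) cat_functor" and \<alpha> \<beta> :: "'o \<Rightarrow> 'k"
  assumes cq: "coequalizer_choice A cq"
    and F: "is_functor C A F" and G: "is_functor C A G"
    and \<alpha>: "is_nat_trans C A F G \<alpha>" and \<beta>: "is_nat_trans C A F G \<beta>"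
begin

abbreviation "L' \<equiv> coeq_functor A cq F G \<alpha> \<beta>"
abbreviation "q \<equiv> coeq_proj cq F G \<alpha> \<beta>"

lemma proj_coequalizer:
  "X \<in> Obj C \<Longrightarrow> is_coequalizer A (FO F X) (FO G X) (\<alpha> X) (\<beta> X) (FO L' X) (q X)"
  using cq fun_obj[OF F] fun_obj[OF G] nat_hom[OF \<alpha>] nat_hom[OF \<beta>]
  by (simp add: coequalizer_choice_def coeq_functor_def coeq_proj_def Let_def)

lemma L'_obj: "X \<in> Obj C \<Longrightarrow> FO L' X \<in> Obj A"
  and q_hom: "X \<in> Obj C \<Longrightarrow> q X \<in> Hom A (FO G X) (FO L' X)"
  and q_coequalizes: "X \<in> Obj C \<Longrightarrow>
    Comp A (FO F X) (FO G X) (FO L' X) (q X) (\<alpha> X) = Comp A (FO F X) (FO G X) (FO L' X) (q X) (\<beta> X)"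
  using proj_coequalizer by (simp_all add: is_coequalizer_def)

lemma q_universal:
  assumes "X \<in> Obj C" "Z \<in> Obj A" "h \<in> Hom A (FO G X) Z"
    and "Comp A (FO F X) (FO G X) Z h (\<alpha> X) = Comp A (FO F X) (FO G X) Z h (\<beta> X)"
  shows "\<exists>!u. u \<in> Hom A (FO L' X) Z \<and> Comp A (FO G X) (FO L' X) Z u (q X) = h"
  using proj_coequalizer[OF assms(1)] assms by (simp add: is_coequalizer_def)

text \<open>If \<open>u q = v q = h\<close>, then \<open>h\<close> coequalizes, so \<open>u\<close> and \<open>v\<close> are both its unique factorization.\<close>

lemma q_epi:
  assumes X: "X \<in> Obj C" and Z: "Z \<in> Obj A"
    and u: "u \<in> Hom A (FO L' X) Z" and v: "v \<in> Hom A (FO L' X) Z"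
    and eq: "Comp A (FO G X) (FO L' X) Z u (q X) = Comp A (FO G X) (FO L' X) Z v (q X)"
  shows "u = v"
proof -
  note A = fun_target[OF G]
  let ?h = "Comp A (FO G X) (FO L' X) Z v (q X)"
  note mem = X Z v A L'_obj q_hom fun_obj[OF F] fun_obj[OF G] nat_hom[OF \<alpha>] nat_hom[OF \<beta>]
  have "?h \<in> Hom A (FO G X) Z" using mem by (simp add: cat_comp)
  moreover have "Comp A (FO F X) (FO G X) Z ?h (\<alpha> X) = Comp A (FO F X) (FO G X) Z ?h (\<beta> X)"
    using mem by (simp add: cat_assoc q_coequalizes)
  ultimately show ?thesis
    using q_universal[OF X Z] u v eq by blast
qed

text \<open>By naturality of \<open>\<alpha>\<close> and \<open>\<beta>\<close>, \<open>q Y \<circ> G f\<close> coequalizes the pair at \<open>X\<close>, so the definite description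
  in the arrow part of the coequalizer functor denotes.\<close>

lemma L'_arrow:
  assumes X: "X \<in> Obj C" and Y: "Y \<in> Obj C" and f: "f \<in> Hom C X Y"
  shows L'_hom: "FA L' X Y f \<in> Hom A (FO L' X) (FO L' Y)"
    and q_square: "Comp A (FO G X) (FO L' X) (FO L' Y) (FA L' X Y f) (q X) =
      Comp A (FO G X) (FO G Y) (FO L' Y) (q Y) (FA G X Y f)"
proof -
  note A = fun_target[OF G]
  let ?h = "Comp A (FO G X) (FO G Y) (FO L' Y) (q Y) (FA G X Y f)"
  let ?P = "\<lambda>u. u \<in> Hom A (FO L' X) (FO L' Y) \<and> Comp A (FO G X) (FO L' X) (FO L' Y) u (q X) = ?h"
  note mem = X Y A fun_obj[OF F] fun_obj[OF G] nat_hom[OF \<alpha>] nat_hom[OF \<beta>] L'_obj q_hom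
    fun_hom[OF G f] fun_hom[OF F f]
  have slide: "Comp A (FO F X) (FO G X) (FO L' Y) ?h (\<gamma> X) =
      Comp A (FO F X) (FO F Y) (FO L' Y) (Comp A (FO F Y) (FO G Y) (FO L' Y) (q Y) (\<gamma> Y)) (FA F X Y f)"
    if "is_nat_trans C A F G \<gamma>" for \<gamma>
    using mem nat_hom[OF that] by (simp add: cat_assoc nat_square[OF that f])
  have "Comp A (FO F X) (FO G X) (FO L' Y) ?h (\<alpha> X) = Comp A (FO F X) (FO G X) (FO L' Y) ?h (\<beta> X)"
    using Y by (simp only: slide[OF \<alpha>] slide[OF \<beta>] q_coequalizes)
  then have "\<exists>!u. ?P u"
    using mem by (intro q_universal) (simp_all add: cat_comp)
  from theI'[OF this] have "?P (FA L' X Y f)"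
    by (simp add: coeq_functor_def Let_def)
  then show "FA L' X Y f \<in> Hom A (FO L' X) (FO L' Y)"
    and "Comp A (FO G X) (FO L' X) (FO L' Y) (FA L' X Y f) (q X) = ?h"
    by simp_all
qed

lemma L'_functor: "is_functor C A L'"
proof -
  note A = fun_target[OF G] and C = fun_source[OF G]
  note mem = A C fun_obj[OF G] fun_hom[OF G] L'_obj q_hom L'_hom
  have "FA L' X X (Id C X) = Id A (FO L' X)" if "X \<in> Obj C" for X
  proof (rule q_epi[of X "FO L' X"])
  qed (use that mem in \<open>simp_all add: cat_id q_square fun_id[OF G] cat_id_left cat_id_right\<close>)
  moreover have "FA L' X Z (Comp C X Y Z g f) =
      Comp A (FO L' X) (FO L' Y) (FO L' Z) (FA L' Y Z g) (FA L' X Y f)"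
    if "X \<in> Obj C" "Y \<in> Obj C" "Z \<in> Obj C" and f: "f \<in> Hom C X Y" and g: "g \<in> Hom C Y Z" for X Y Z f g
  proof (rule q_epi)
    have "Comp A (FO G X) (FO L' X) (FO L' Z)
        (Comp A (FO L' X) (FO L' Y) (FO L' Z) (FA L' Y Z g) (FA L' X Y f)) (q X) =
        Comp A (FO G X) (FO G Y) (FO L' Z)
          (Comp A (FO G Y) (FO L' Y) (FO L' Z) (FA L' Y Z g) (q Y)) (FA G X Y f)"
      using that mem by (simp add: cat_assoc q_square[OF _ _ f])
    also have "\<dots> = Comp A (FO G X) (FO G Z) (FO L' Z) (q Z) (FA G X Z (Comp C X Y Z g f))"
      using that mem by (simp add: cat_assoc q_square fun_comp[OF G])
    finally show "Comp A (FO G X) (FO L' X) (FO L' Z) (FA L' X Z (Comp C X Y Z g f)) (q X) =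
        Comp A (FO G X) (FO L' X) (FO L' Z)
          (Comp A (FO L' X) (FO L' Y) (FO L' Z) (FA L' Y Z g) (FA L' X Y f)) (q X)"
      using that mem by (simp add: q_square cat_comp)
  qed (use that mem in \<open>simp_all add: cat_comp\<close>)
  ultimately show ?thesis
    using A C L'_obj L'_hom by (simp add: is_functor_def)
qed

end

section \<open>The inductive step of a tower\<close>

text \<open>The step common to both towers.  The morphism \<open>\<rho> Z\<close> is the structure put on \<open>R Z\<close>; the last
  assumption relates the pair \<open>\<alpha>, \<beta>\<close>, which defines the new left adjoint, to the morphisms of the new
  category.\<close>

locale tower_step =
  adjoint_pair A S + coequalizer_functor A cq C' F "adj_L S \<odot> forget" \<alpha> \<beta>
  for A :: "('a, 'k) category" and S :: "(('b, 'm) tower_obj, 'm, 'a, 'k) adjunction"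
    and cq C' F \<alpha> \<beta> +
  fixes \<rho> :: "'a \<Rightarrow> 'm"
  assumes forget_functor: "is_functor C' C forget"
    and R': "is_functor A C' (comparison (adj_R S) \<rho>)"
    and Id': "\<And>P. Id C' P = Id C (underlying P)"
    and Comp': "\<And>P P' P''. Comp C' P P' P'' = Comp C (underlying P) (underlying P') (underlying P'')"
    and coequalizes_iff: "\<And>P Z h. P \<in> Obj C' \<Longrightarrow> Z \<in> Obj A \<Longrightarrow> h \<in> Hom A (Lo (underlying P)) Z \<Longrightarrow>
      Comp A (FO F P) (Lo (underlying P)) Z h (\<alpha> P) = Comp A (FO F P) (Lo (underlying P)) Z h (\<beta> P) \<longleftrightarrow>
      transpose (underlying P) Z h \<in> Hom C' P (Ext (Ro Z) (\<rho> Z))"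
begin

abbreviation "S' \<equiv> next_adjunction A S C' (comparison (adj_R S) \<rho>) L' q"
abbreviation "R'o Z \<equiv> Ext (Ro Z) (\<rho> Z)"

lemma forget_obj: "P \<in> Obj C' \<Longrightarrow> underlying P \<in> Obj C"
  and forget_hom: "f \<in> Hom C' P P' \<Longrightarrow> P \<in> Obj C' \<Longrightarrow> P' \<in> Obj C' \<Longrightarrow>
    f \<in> Hom C (underlying P) (underlying P')"
  using fun_obj[OF forget_functor] fun_hom[OF forget_functor] by simp_all

lemma R'_obj: "Z \<in> Obj A \<Longrightarrow> R'o Z \<in> Obj C'"
  and R'_hom: "f \<in> Hom A Y Z \<Longrightarrow> Y \<in> Obj A \<Longrightarrow> Z \<in> Obj A \<Longrightarrow> Ra Y Z f \<in> Hom C' (R'o Y) (R'o Z)"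
  using fun_obj[OF R'] fun_hom[OF R'] by simp_all

lemma L'_fun: "P \<in> Obj C' \<Longrightarrow> FO L' P \<in> Obj A"
  and L'_fun_hom: "f \<in> Hom C' P P' \<Longrightarrow> P \<in> Obj C' \<Longrightarrow> P' \<in> Obj C' \<Longrightarrow>
    FA L' P P' f \<in> Hom A (FO L' P) (FO L' P')"
  using fun_obj[OF L'_functor] fun_hom[OF L'_functor] by simp_all

lemma unit'_eq: "adj_unit S' P = transpose (underlying P) (FO L' P) (q P)"
  by (simp add: next_adjunction_def Let_def vcomp_def whiskerL_def whiskerR_def transpose_def)

lemma unit'_hom:
  assumes P: "P \<in> Obj C'"
  shows "adj_unit S' P \<in> Hom C' P (R'o (FO L' P))"
  using coequalizes_iff[OF P, of "FO L' P" "q P"] q_coequalizes[OF P] q_hom[OF P] L'_obj[OF P]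
  by (simp add: unit'_eq)

text \<open>The transpose of \<open>\<epsilon> Z\<close> is the identity of \<open>R Z\<close>, certainly a morphism \<open>R' Z \<rightarrow> R' Z\<close>; hence \<open>\<epsilon> Z\<close>
  coequalizes the pair and factors through \<open>q\<close>.\<close>

lemma counit':
  assumes Z: "Z \<in> Obj A"
  shows counit'_hom: "adj_counit S' Z \<in> Hom A (FO L' (R'o Z)) Z"
    and counit'_proj: "Comp A (Lo (Ro Z)) (FO L' (R'o Z)) Z (adj_counit S' Z) (q (R'o Z)) = counit Z"
proof -
  have "transpose (Ro Z) Z (counit Z) = Id C' (R'o Z)"
    using Z by (simp add: transpose_def triangle_R Id')
  then have "transpose (Ro Z) Z (counit Z) \<in> Hom C' (R'o Z) (R'o Z)"
    using cat_id[OF fun_source[OF forget_functor] R'_obj[OF Z]] by simp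
  then have ex: "\<exists>!e. e \<in> Hom A (FO L' (R'o Z)) Z \<and>
      Comp A (Lo (Ro Z)) (FO L' (R'o Z)) Z e (q (R'o Z)) = counit Z" (is "\<exists>!e. ?P e")
    using q_universal[OF R'_obj[OF Z] Z, of "counit Z"]
      coequalizes_iff[OF R'_obj[OF Z] Z, of "counit Z"] counit_hom[OF Z] by simp
  have "adj_counit S' Z = (THE e. ?P e)"
    by (simp add: next_adjunction_def Let_def whiskerR_def)
  with theI'[OF ex] have "?P (adj_counit S' Z)" by simp
  then show "adj_counit S' Z \<in> Hom A (FO L' (R'o Z)) Z"
    and "Comp A (Lo (Ro Z)) (FO L' (R'o Z)) Z (adj_counit S' Z) (q (R'o Z)) = counit Z"
    by simp_all
qed

lemmas mem' = mem_simps forget_obj forget_hom R'_obj R'_hom L'_fun L'_fun_hom unit'_hom counit'_hom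

lemma q_hom': "P \<in> Obj C' \<Longrightarrow> q P \<in> Hom A (Lo (underlying P)) (FO L' P)"
  using q_hom by simp

lemma q_square': "P \<in> Obj C' \<Longrightarrow> P' \<in> Obj C' \<Longrightarrow> f \<in> Hom C' P P' \<Longrightarrow>
    Comp A (Lo (underlying P)) (FO L' P) (FO L' P') (FA L' P P' f) (q P) =
    Comp A (Lo (underlying P)) (Lo (underlying P')) (FO L' P') (q P')
      (La (underlying P) (underlying P') f)"
  using q_square by simp

lemma unit'_nat: "is_nat_trans C' C' id_functor (comparison (adj_R S) \<rho> \<odot> L') (adj_unit S')"
  unfolding is_nat_trans_def
proof (intro conjI ballI)
  fix P P' f assume P: "P \<in> Obj C'" and P': "P' \<in> Obj C'" and f: "f \<in> Hom C' P P'"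
  let ?X = "underlying P" and ?X' = "underlying P'"
  have "Comp C ?X (Ro (FO L' P)) (Ro (FO L' P')) (Ra (FO L' P) (FO L' P') (FA L' P P' f))
      (adj_unit S' P) = Comp C ?X (Ro (Lo ?X)) (Ro (FO L' P'))
      (Ra (Lo ?X) (FO L' P')
        (Comp A (Lo ?X) (FO L' P) (FO L' P') (FA L' P P' f) (q P))) (unit ?X)"
    using P P' f by (simp add: unit'_eq transpose_def mem' q_hom' cat_assoc comp_simps)
  also have "\<dots> = Comp C ?X ?X' (Ro (FO L' P')) (adj_unit S' P') f"
    using P P' f
    by (simp add: unit'_eq transpose_def mem' q_hom' q_square' cat_assoc comp_simps unit_square)
  finally show "Comp C' (FO id_functor P) (FO (comparison (adj_R S) \<rho> \<odot> L') P)
      (FO (comparison (adj_R S) \<rho> \<odot> L') P') (FA (comparison (adj_R S) \<rho> \<odot> L') P P' f) (adj_unit S' P) =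
      Comp C' (FO id_functor P) (FO id_functor P') (FO (comparison (adj_R S) \<rho> \<odot> L') P')
        (adj_unit S' P') (FA id_functor P P' f)"
    by (simp add: Comp')
qed (simp add: unit'_hom)

lemma counit'_nat: "is_nat_trans A A (L' \<odot> comparison (adj_R S) \<rho>) id_functor (adj_counit S')"
  unfolding is_nat_trans_def
proof (intro conjI ballI)
  fix Y Z f assume Y: "Y \<in> Obj A" and Z: "Z \<in> Obj A" and f: "f \<in> Hom A Y Z"
  let ?Y = "R'o Y" and ?Z = "R'o Z"
  have "Comp A (FO L' ?Y) Y Z f (adj_counit S' Y) =
      Comp A (FO L' ?Y) (FO L' ?Z) Z (adj_counit S' Z) (FA L' ?Y ?Z (Ra Y Z f))"
  proof (rule q_epi[of ?Y])
    have "Comp A (Lo (Ro Y)) (FO L' ?Y) Z (Comp A (FO L' ?Y) Y Z f (adj_counit S' Y)) (q ?Y) =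
        Comp A (Lo (Ro Y)) Y Z f (counit Y)"
      using Y Z f q_hom'[OF R'_obj[OF Y]] by (simp add: mem' cat_assoc counit'_proj)
    also have "\<dots> = Comp A (Lo (Ro Y)) (Lo (Ro Z)) Z
        (Comp A (Lo (Ro Z)) (FO L' ?Z) Z (adj_counit S' Z) (q ?Z)) (La (Ro Y) (Ro Z) (Ra Y Z f))"
      using Y Z f by (simp add: counit'_proj counit_square)
    also have "\<dots> = Comp A (Lo (Ro Y)) (FO L' ?Y) Z
        (Comp A (FO L' ?Y) (FO L' ?Z) Z (adj_counit S' Z) (FA L' ?Y ?Z (Ra Y Z f))) (q ?Y)"
      using Y Z f q_hom'[OF R'_obj[OF Y]] q_hom'[OF R'_obj[OF Z]]
        q_square'[OF R'_obj[OF Y] R'_obj[OF Z] R'_hom[OF f Y Z]]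
      by (simp add: mem' cat_assoc)
    finally show "Comp A (FO (adj_L S \<odot> forget) ?Y) (FO L' ?Y) Z
        (Comp A (FO L' ?Y) Y Z f (adj_counit S' Y)) (q ?Y) =
      Comp A (FO (adj_L S \<odot> forget) ?Y) (FO L' ?Y) Z
        (Comp A (FO L' ?Y) (FO L' ?Z) Z (adj_counit S' Z) (FA L' ?Y ?Z (Ra Y Z f))) (q ?Y)"
      by simp
  qed (use Y Z f in \<open>simp_all add: mem'\<close>)
  then show "Comp A (FO (L' \<odot> comparison (adj_R S) \<rho>) Y) (FO id_functor Y) (FO id_functor Z)
      (FA id_functor Y Z f) (adj_counit S' Y) =
      Comp A (FO (L' \<odot> comparison (adj_R S) \<rho>) Y) (FO (L' \<odot> comparison (adj_R S) \<rho>) Z) (FO id_functor Z)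
      (adj_counit S' Z) (FA (L' \<odot> comparison (adj_R S) \<rho>) Y Z f)"
    by simp
qed (simp add: counit'_hom)

lemma triangle_L':
  assumes P: "P \<in> Obj C'"
  shows "Comp A (FO L' P) (FO L' (R'o (FO L' P))) (FO L' P) (adj_counit S' (FO L' P))
    (FA L' P (R'o (FO L' P)) (adj_unit S' P)) = Id A (FO L' P)" (is "?l = _")
proof (rule q_epi[OF P])
  let ?X = "underlying P" and ?Q = "FO L' P"
  note Q = L'_obj[OF P]
  have "Comp A (Lo ?X) ?Q ?Q ?l (q P) =
      Comp A (Lo ?X) (Lo (Ro ?Q)) ?Q
        (Comp A (Lo (Ro ?Q)) (FO L' (R'o ?Q)) ?Q (adj_counit S' ?Q) (q (R'o ?Q)))
        (La ?X (Ro ?Q) (adj_unit S' P))"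
    using P Q q_hom'[OF P] q_hom'[OF R'_obj[OF Q]] q_square'[OF P R'_obj[OF Q] unit'_hom[OF P]]
      forget_hom[OF unit'_hom[OF P] P R'_obj[OF Q]]
    by (simp add: mem' cat_assoc)
  also have "\<dots> = q P"
    using P by (simp add: counit'_proj Q unit'_eq untranspose forget_obj q_hom')
  finally show "Comp A (FO (adj_L S \<odot> forget) P) ?Q ?Q ?l (q P) =
      Comp A (FO (adj_L S \<odot> forget) P) ?Q ?Q (Id A ?Q) (q P)"
    using P Q q_hom'[OF P] by (simp add: mem' cat_id_left)
qed (use P in \<open>simp_all add: mem'\<close>)

lemma triangle_R':
  assumes Z: "Z \<in> Obj A"
  shows "Comp C (Ro Z) (Ro (FO L' (R'o Z))) (Ro Z) (Ra (FO L' (R'o Z)) Z (adj_counit S' Z))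
    (adj_unit S' (R'o Z)) = Id C (Ro Z)"
proof -
  have "Comp C (Ro Z) (Ro (FO L' (R'o Z))) (Ro Z) (Ra (FO L' (R'o Z)) Z (adj_counit S' Z))
      (adj_unit S' (R'o Z)) = Comp C (Ro Z) (Ro (Lo (Ro Z))) (Ro Z)
      (Ra (Lo (Ro Z)) Z (Comp A (Lo (Ro Z)) (FO L' (R'o Z)) Z (adj_counit S' Z) (q (R'o Z))))
      (unit (Ro Z))"
    using Z q_hom'[OF R'_obj[OF Z]]
    by (simp add: unit'_eq transpose_def mem' cat_assoc comp_simps)
  then show ?thesis using Z by (simp add: counit'_proj triangle_R)
qed

lemma next_is_adjunction: "is_adjunction A S'"
proof -
  have "adj_cat S' = C'" "adj_L S' = L'" "adj_R S' = comparison (adj_R S) \<rho>"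
    by (simp_all add: next_adjunction_def Let_def)
  then show ?thesis
    using L'_functor R' unit'_nat counit'_nat triangle_L' triangle_R'
    by (simp add: is_adjunction_def Let_def vcomp_def whiskerL_def whiskerR_def id_trans_def Id' Comp')
qed

end

section \<open>Both towers consist of adjunctions\<close>

lemma structured_category_simps [simp]:
  "P \<in> Obj (structured_category B C T U) \<longleftrightarrow>
     (\<exists>X b. P = Ext X b \<and> X \<in> Obj C \<and> b \<in> Hom B (FO T X) (FO U X))"
  "Id (structured_category B C T U) P = Id C (underlying P)"
  "Comp (structured_category B C T U) P P' P'' = Comp C (underlying P) (underlying P') (underlying P'')"
  by (simp_all add: structured_category_def)

lemma structured_hom_iff:
  "f \<in> Hom (structured_category B C T U) P P' \<longleftrightarrow> f \<in> Hom C (underlying P) (underlying P') \<and>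
     Comp B (FO T (underlying P)) (FO U (underlying P)) (FO U (underlying P'))
       (FA U (underlying P) (underlying P') f) (action P) =
     Comp B (FO T (underlying P)) (FO T (underlying P')) (FO U (underlying P'))
       (action P') (FA T (underlying P) (underlying P') f)"
  by (simp add: structured_category_def)

lemma structured_category_is_category:
  assumes T: "is_functor C B T" and U: "is_functor C B U"
  shows "is_category (structured_category B C T U)" (is "is_category ?D")
proof -
  note C = fun_source[OF T] and B = fun_target[OF T]
  note mem = C B fun_obj[OF T] fun_obj[OF U] fun_hom[OF T] fun_hom[OF U] cat_id cat_comp
  have "Id ?D P \<in> Hom ?D P P" if "P \<in> Obj ?D" for P
    using that mem by (auto simp: structured_hom_iff fun_id[OF T] fun_id[OF U] cat_id_left cat_id_right)
  moreover have "Comp ?D P P' P'' g f \<in> Hom ?D P P''"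
    if P: "P \<in> Obj ?D" "P' \<in> Obj ?D" "P'' \<in> Obj ?D" and f: "f \<in> Hom ?D P P'" and g: "g \<in> Hom ?D P' P''"
    for P P' P'' f g
  proof -
    obtain X b X' b' X'' b'' where eqs: "P = Ext X b" "P' = Ext X' b'" "P'' = Ext X'' b''"
      and objs: "X \<in> Obj C" "X' \<in> Obj C" "X'' \<in> Obj C"
      and bs: "b \<in> Hom B (FO T X) (FO U X)" "b' \<in> Hom B (FO T X') (FO U X')"
        "b'' \<in> Hom B (FO T X'') (FO U X'')"
      using P by auto
    have f': "f \<in> Hom C X X'" and g': "g \<in> Hom C X' X''"
      and sq: "Comp B (FO T X) (FO U X) (FO U X') (FA U X X' f) b =
          Comp B (FO T X) (FO T X') (FO U X') b' (FA T X X' f)"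
        "Comp B (FO T X') (FO U X') (FO U X'') (FA U X' X'' g) b' =
          Comp B (FO T X') (FO T X'') (FO U X'') b'' (FA T X' X'' g)"
      using f g by (simp_all add: eqs structured_hom_iff)
    note mem' = mem objs bs f' g' fun_comp[OF T f' g'] fun_comp[OF U f' g']
    have "Comp B (FO T X) (FO U X) (FO U X'') (FA U X X'' (Comp C X X' X'' g f)) b =
        Comp B (FO T X) (FO T X') (FO U X'')
          (Comp B (FO T X') (FO U X') (FO U X'') (FA U X' X'' g) b') (FA T X X' f)"
      using mem' by (simp add: cat_assoc sq(1))
    also have "\<dots> = Comp B (FO T X) (FO T X'') (FO U X'') b'' (FA T X X'' (Comp C X X' X'' g f))"
      using mem' by (simp add: cat_assoc sq(2))
    finally show ?thesis
      using mem' by (simp add: eqs structured_hom_iff)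
  qed
  ultimately show ?thesis
    unfolding is_category_def
    using C by (auto simp: structured_hom_iff cat_id_left cat_id_right cat_assoc)
qed

lemma full_subcategory_is_category:
  assumes "is_category D" and "Obj D' \<subseteq> Obj D" and "Hom D' = Hom D" and "Id D' = Id D"
    and "Comp D' = Comp D"
  shows "is_category D'"
  using assms unfolding is_category_def by (simp add: subset_iff)

lemma em_category_simps [simp]:
  "P \<in> Obj (em_category C T mult \<eta>) \<longleftrightarrow>
     (\<exists>V \<mu>. P = Ext V \<mu> \<and> V \<in> Obj C \<and> \<mu> \<in> Hom C (FO T V) V \<and>
        Comp C V (FO T V) V \<mu> (\<eta> V) = Id C V \<and>
        Comp C (FO T (FO T V)) (FO T V) V \<mu> (FA T (FO T V) V \<mu>) =
        Comp C (FO T (FO T V)) (FO T V) V \<mu> (mult V))"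
  "Hom (em_category C T mult \<eta>) = Hom (structured_category C C T id_functor)"
  "Id (em_category C T mult \<eta>) P = Id C (underlying P)"
  "Comp (em_category C T mult \<eta>) P P' P'' = Comp C (underlying P) (underlying P') (underlying P'')"
  by (simp_all add: em_category_def structured_category_def)

text \<open>Algebras form a full subcategory of the pairs \<open>(V, \<mu> : T V \<rightarrow> V)\<close> without axioms.\<close>

lemma em_category_is_category:
  assumes T: "is_functor C C T"
  shows "is_category (em_category C T mult \<eta>)"
  by (rule full_subcategory_is_category[OF structured_category_is_category[OF T
          id_is_functor[OF fun_source[OF T]]]])
    (auto simp: fun_eq_iff)

lemma forget_is_functor:
  assumes "is_category C" and "is_category C'"
    and "\<And>P. P \<in> Obj C' \<Longrightarrow> underlying P \<in> Obj C"
    and "\<And>P P' f. f \<in> Hom C' P P' \<Longrightarrow> f \<in> Hom C (underlying P) (underlying P')"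
    and "\<And>P. Id C' P = Id C (underlying P)"
    and "\<And>P P' P''. Comp C' P P' P'' = Comp C (underlying P) (underlying P') (underlying P'')"
  shows "is_functor C' C forget"
  using assms by (simp add: is_functor_def)

lemma comparison_is_functor:
  assumes R: "is_functor A C R" and C': "is_category C'"
    and "\<And>Z. Z \<in> Obj A \<Longrightarrow> Ext (FO R Z) (\<rho> Z) \<in> Obj C'"
    and "\<And>Y Z f. Y \<in> Obj A \<Longrightarrow> Z \<in> Obj A \<Longrightarrow> f \<in> Hom A Y Z \<Longrightarrow>
      FA R Y Z f \<in> Hom C' (Ext (FO R Y) (\<rho> Y)) (Ext (FO R Z) (\<rho> Z))"
    and "\<And>P. Id C' P = Id C (underlying P)"
    and "\<And>P P' P''. Comp C' P P' P'' = Comp C (underlying P) (underlying P') (underlying P'')"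
  shows "is_functor A C' (comparison R \<rho>)"
  using assms by (simp add: is_functor_def)

context adjoint_pair
begin

lemma RL_functor: "is_functor C C (adj_R S \<odot> adj_L S)"
  by (rule comp_is_functor[OF L_functor R_functor])

lemma R_counit_square:
  assumes "Y \<in> Obj A" "Z \<in> Obj A" "f \<in> Hom A Y Z"
  shows "Comp C (Ro (Lo (Ro Y))) (Ro Y) (Ro Z) (Ra Y Z f) (Ra (Lo (Ro Y)) Y (counit Y)) =
    Comp C (Ro (Lo (Ro Y))) (Ro (Lo (Ro Z))) (Ro Z) (Ra (Lo (Ro Z)) Z (counit Z))
      (Ra (Lo (Ro Y)) (Lo (Ro Z)) (La (Ro Y) (Ro Z) (Ra Y Z f)))"
proof -
  have "Ra (Lo (Ro Y)) Z (Comp A (Lo (Ro Y)) Y Z f (counit Y)) =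
      Ra (Lo (Ro Y)) Z (Comp A (Lo (Ro Y)) (Lo (Ro Z)) Z (counit Z) (La (Ro Y) (Ro Z) (Ra Y Z f)))"
    using assms by (simp add: counit_square)
  then show ?thesis using assms by (simp add: mem_simps comp_simps)
qed

end

text \<open>The transposes of \<open>h \<circ> L \<mu>\<close> and \<open>h \<circ> \<epsilon> L\<close> are \<open>h\<^sup>\<sharp> \<circ> \<mu>\<close> and \<open>R h\<close>, with \<open>h\<^sup>\<sharp>\<close> the transpose of
  \<open>h\<close>.  Their equality says that \<open>h\<^sup>\<sharp>\<close> is a morphism of algebras to \<open>(R Z, R \<epsilon> Z)\<close>.\<close>

lemma monadic_step_is_adjunction:
  fixes S :: "(('b, 'm) tower_obj, 'm, 'a, 'k) adjunction"
  assumes adj: "is_adjunction A S" and cq: "coequalizer_choice A cq"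
  shows "is_adjunction A (monadic_step A cq S)"
proof -
  interpret adjoint_pair A S by (rule adjoint_pair.intro[OF adj])
  define \<rho> where "\<rho> = whiskerL (adj_R S) (adj_L S \<odot> adj_R S) id_functor counit"
  define C' where "C' = em_category C (adj_R S \<odot> adj_L S) (whiskerR \<rho> (adj_L S)) unit"
  define F where "F = adj_L S \<odot> adj_R S \<odot> adj_L S \<odot>
    (forget :: (('b, 'm) tower_obj, 'm, ('b, 'm) tower_obj, 'm) cat_functor)"
  define \<alpha> where "\<alpha> = whiskerL (adj_L S) (adj_R S \<odot> adj_L S \<odot> forget) forget action"
  define \<beta> where "\<beta> = whiskerR counit (adj_L S \<odot>
    (forget :: (('b, 'm) tower_obj, 'm, ('b, 'm) tower_obj, 'm) cat_functor))"
  have \<rho>: "\<rho> Z = Ra (Lo (Ro Z)) Z (counit Z)" for Z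
    by (simp add: \<rho>_def whiskerL_def)
  have \<alpha>: "\<alpha> P = La (Ro (Lo (underlying P))) (underlying P) (action P)" for P
    by (simp add: \<alpha>_def whiskerL_def)
  have \<beta>: "\<beta> P = counit (Lo (underlying P))" for P
    by (simp add: \<beta>_def whiskerR_def)
  have cat': "is_category C'"
    unfolding C'_def by (rule em_category_is_category[OF RL_functor])
  have obj': "P \<in> Obj C' \<Longrightarrow> underlying P \<in> Obj C \<and>
      action P \<in> Hom C (Ro (Lo (underlying P))) (underlying P)" for P
    by (auto simp: C'_def)
  have hom': "f \<in> Hom C' P P' \<longleftrightarrow> f \<in> Hom C (underlying P) (underlying P') \<and>
      Comp C (Ro (Lo (underlying P))) (underlying P) (underlying P') f (action P) =
      Comp C (Ro (Lo (underlying P))) (Ro (Lo (underlying P'))) (underlying P') (action P')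
        (Ra (Lo (underlying P)) (Lo (underlying P')) (La (underlying P) (underlying P') f))" for f P P'
    by (simp add: C'_def structured_hom_iff)
  have id_comp': "Id C' P = Id C (underlying P)"
    "Comp C' P P' P'' = Comp C (underlying P) (underlying P') (underlying P'')" for P P' P''
    by (simp_all add: C'_def)
  have forget: "is_functor C' C forget"
    using cats(2) cat' obj' hom' id_comp' by (intro forget_is_functor) simp_all
  have R': "is_functor A C' (comparison (adj_R S) \<rho>)"
  proof (rule comparison_is_functor[OF R_functor cat'])
    fix Z assume Z: "Z \<in> Obj A"
    show "Ext (Ro Z) (\<rho> Z) \<in> Obj C'"
      using Z R_counit_square[of "Lo (Ro Z)" Z "counit Z"]
      by (simp add: C'_def \<rho> whiskerR_def mem_simps triangle_R)
  qed (simp_all add: hom' \<rho> mem_simps R_counit_square id_comp')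
  have F: "is_functor C' A F"
    unfolding F_def by (intro comp_is_functor[OF forget] comp_is_functor[OF L_functor]
        comp_is_functor[OF R_functor] L_functor)
  have G: "is_functor C' A (adj_L S \<odot> forget)"
    by (rule comp_is_functor[OF forget L_functor])
  have \<alpha>_nat: "is_nat_trans C' A F (adj_L S \<odot> forget) \<alpha>"
    unfolding is_nat_trans_def
  proof (intro conjI ballI)
    fix P P' f assume P: "P \<in> Obj C'" and P': "P' \<in> Obj C'" and f: "f \<in> Hom C' P P'"
    let ?X = "underlying P" and ?X' = "underlying P'"
    have sq: "Comp C (Ro (Lo ?X)) ?X ?X' f (action P) =
        Comp C (Ro (Lo ?X)) (Ro (Lo ?X')) ?X' (action P') (Ra (Lo ?X) (Lo ?X') (La ?X ?X' f))"
      using f by (simp add: hom')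
    have f': "f \<in> Hom C ?X ?X'" using f by (simp add: hom')
    have "Comp A (Lo (Ro (Lo ?X))) (Lo ?X) (Lo ?X') (La ?X ?X' f) (\<alpha> P) =
        La (Ro (Lo ?X)) ?X' (Comp C (Ro (Lo ?X)) ?X ?X' f (action P))"
      using obj'[OF P] obj'[OF P'] f' by (simp add: \<alpha> mem_simps comp_simps)
    also have "\<dots> = Comp A (Lo (Ro (Lo ?X))) (Lo (Ro (Lo ?X'))) (Lo ?X') (\<alpha> P')
        (La (Ro (Lo ?X)) (Ro (Lo ?X')) (Ra (Lo ?X) (Lo ?X') (La ?X ?X' f)))"
      using obj'[OF P] obj'[OF P'] f' unfolding sq by (simp add: \<alpha> mem_simps comp_simps)
    finally show "Comp A (FO F P) (FO (adj_L S \<odot> forget) P) (FO (adj_L S \<odot> forget) P')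
        (FA (adj_L S \<odot> forget) P P' f) (\<alpha> P) =
        Comp A (FO F P) (FO F P') (FO (adj_L S \<odot> forget) P') (\<alpha> P') (FA F P P' f)"
      by (simp add: F_def)
  qed (use obj' in \<open>simp add: F_def \<alpha> mem_simps\<close>)
  have \<beta>_nat: "is_nat_trans C' A F (adj_L S \<odot> forget) \<beta>"
    using obj' hom' by (simp add: is_nat_trans_def F_def \<beta> mem_simps counit_square)
  have iff: "Comp A (FO F P) (Lo (underlying P)) Z h (\<alpha> P) = Comp A (FO F P) (Lo (underlying P)) Z h (\<beta> P) \<longleftrightarrow>
      transpose (underlying P) Z h \<in> Hom C' P (Ext (Ro Z) (\<rho> Z))"
    if P: "P \<in> Obj C'" and Z: "Z \<in> Obj A" and h: "h \<in> Hom A (Lo (underlying P)) Z" for P Z h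
  proof -
    let ?X = "underlying P" and ?\<mu> = "action P"
    have X: "?X \<in> Obj C" and \<mu>: "?\<mu> \<in> Hom C (Ro (Lo ?X)) ?X" using obj'[OF P] by simp_all
    have "Comp A (FO F P) (Lo ?X) Z h (\<alpha> P) = Comp A (FO F P) (Lo ?X) Z h (\<beta> P) \<longleftrightarrow>
        transpose (Ro (Lo ?X)) Z (Comp A (Lo (Ro (Lo ?X))) (Lo ?X) Z h (La (Ro (Lo ?X)) ?X ?\<mu>)) =
        transpose (Ro (Lo ?X)) Z (Comp A (Lo (Ro (Lo ?X))) (Lo ?X) Z h (counit (Lo ?X)))"
      using X \<mu> Z h by (simp add: transpose_inject F_def \<alpha> \<beta> mem_simps)
    also have "\<dots> \<longleftrightarrow> Comp C (Ro (Lo ?X)) ?X (Ro Z) (transpose ?X Z h) ?\<mu> = Ra (Lo ?X) Z h"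
      using X \<mu> Z h by (simp add: transpose_precomp transpose_counit mem_simps)
    also have "\<dots> \<longleftrightarrow> transpose ?X Z h \<in> Hom C' P (Ext (Ro Z) (\<rho> Z))"
      using X Z h by (simp add: hom' \<rho> transpose_hom R_untranspose)
    finally show ?thesis .
  qed
  interpret tower_step A S cq C' F \<alpha> \<beta> \<rho>
    using cq F G \<alpha>_nat \<beta>_nat forget R' id_comp' iff by unfold_locales
  show ?thesis
    using next_is_adjunction
    by (simp add: monadic_step_def Let_def \<rho>_def C'_def F_def \<alpha>_def \<beta>_def)
qed

text \<open>The invariant of the decomposition: \<open>S\<close> is a stage over stage 0, which is \<open>S0\<close>, with forgetful
  functor \<open>U\<close>.  The last assumption is \<open>U \<eta>\<^bsub>[n]\<^esub> = R \<pi> \<circ> \<eta> U\<close>.\<close>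

locale lies_over = base: adjoint_pair A S0 + adjoint_pair A S
  for A :: "('a, 'k) category" and S0 S :: "(('b, 'm) tower_obj, 'm, 'a, 'k) adjunction" +
  fixes U :: "(('b, 'm) tower_obj, 'm, ('b, 'm) tower_obj, 'm) cat_functor"
    and \<pi> :: "('b, 'm) tower_obj \<Rightarrow> 'k"
  assumes U: "is_functor C base.C U"
    and FA_U: "\<And>X Y f. FA U X Y f = f"
    and UR: "functor_eq A (U \<odot> adj_R S) (adj_R S0)"
    and \<pi>_nat: "is_nat_trans C A (adj_L S0 \<odot> U) (adj_L S) \<pi>"
    and unit_eq: "\<And>X. X \<in> Obj C \<Longrightarrow> unit X = base.transpose (FO U X) (Lo X) (\<pi> X)"
begin

abbreviation "Uo \<equiv> FO U"

lemma UR_obj: "Z \<in> Obj A \<Longrightarrow> Uo (Ro Z) = base.Ro Z"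
  and R_arrow: "f \<in> Hom A Y Z \<Longrightarrow> Y \<in> Obj A \<Longrightarrow> Z \<in> Obj A \<Longrightarrow> Ra Y Z f = base.Ra Y Z f"
  using UR by (simp_all add: functor_eq_def FA_U)

lemma U_obj: "X \<in> Obj C \<Longrightarrow> Uo X \<in> Obj base.C"
  and U_hom: "f \<in> Hom C X Y \<Longrightarrow> X \<in> Obj C \<Longrightarrow> Y \<in> Obj C \<Longrightarrow> f \<in> Hom base.C (Uo X) (Uo Y)"
  using fun_obj[OF U] fun_hom[OF U] by (simp_all add: FA_U)

lemma comp_in_base:
  "f \<in> Hom C X Y \<Longrightarrow> g \<in> Hom C Y Z \<Longrightarrow> X \<in> Obj C \<Longrightarrow> Y \<in> Obj C \<Longrightarrow> Z \<in> Obj C \<Longrightarrow>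
   Comp C X Y Z g f = Comp base.C (Uo X) (Uo Y) (Uo Z) g f"
  using fun_comp[OF U] by (simp add: FA_U)

lemma \<pi>_hom: "X \<in> Obj C \<Longrightarrow> \<pi> X \<in> Hom A (base.Lo (Uo X)) (Lo X)"
  using nat_hom[OF \<pi>_nat] by simp

lemma \<pi>_square: "f \<in> Hom C X Y \<Longrightarrow> X \<in> Obj C \<Longrightarrow> Y \<in> Obj C \<Longrightarrow>
  Comp A (base.Lo (Uo X)) (base.Lo (Uo Y)) (Lo Y) (\<pi> Y) (base.La (Uo X) (Uo Y) f) =
  Comp A (base.Lo (Uo X)) (Lo X) (Lo Y) (La X Y f) (\<pi> X)"
  using nat_square[OF \<pi>_nat] by (simp add: FA_U)

lemmas over_simps = mem_simps base.mem_simps U_obj U_hom \<pi>_hom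

lemma transpose_in_base:
  assumes X: "X \<in> Obj C" and Z: "Z \<in> Obj A" and h: "h \<in> Hom A (Lo X) Z"
  shows "transpose X Z h =
    base.transpose (Uo X) Z (Comp A (base.Lo (Uo X)) (Lo X) Z h (\<pi> X))"
proof -
  have "transpose X Z h =
      Comp base.C (Uo X) (base.Ro (Lo X)) (base.Ro Z) (base.Ra (Lo X) Z h) (unit X)"
    using X Z h fun_hom[OF R_functor h] by (simp add: transpose_def comp_in_base mem_simps UR_obj R_arrow)
  then show ?thesis
    using X Z h by (simp add: unit_eq base.transpose_def over_simps base.comp_simps cat_assoc)
qed

context
  fixes cq :: "('a, 'k) coequalizers" and n :: nat
  assumes cq: "coequalizer_choice A cq" and U_def: "U = forget_to 0 n"
begin

text \<open>The criterion is checked by transposing along \<open>(L, R)\<close> of stage 0, not along the adjunction of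
  stage \<open>n\<close>: \<open>h \<circ> \<pi> \<circ> L b\<close> has transpose \<open>(h \<pi>)\<^sup>\<sharp> \<circ> b\<close>, and \<open>(h \<pi>)\<^sup>\<sharp>\<close> is the underlying morphism of the
  stage \<open>n\<close> transpose of \<open>h\<close> by \<open>transpose_in_base\<close>.\<close>

lemma decomposition_step_lies_over:
  defines "S' \<equiv> fst (decomposition_step A cq S0 n (S, \<pi>))"
    and "\<pi>' \<equiv> snd (decomposition_step A cq S0 n (S, \<pi>))"
  shows "lies_over A S0 S' (forget_to 0 (Suc n)) \<pi>'"
proof -
  define T where "T = adj_R S0 \<odot> adj_L S"
  define \<rho> where "\<rho> = whiskerL (adj_R S0) (adj_L S \<odot> adj_R S) id_functor counit"
  define C' where "C' = structured_category base.C C T U"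
  define F where "F = adj_L S0 \<odot> adj_R S0 \<odot> adj_L S \<odot>
    (forget :: (('b, 'm) tower_obj, 'm, ('b, 'm) tower_obj, 'm) cat_functor)"
  define \<alpha> where "\<alpha> = vcomp A F (adj_L S0 \<odot> U \<odot> forget) (adj_L S \<odot> forget) (whiskerR \<pi> forget)
      (whiskerL (adj_L S0) (adj_R S0 \<odot> adj_L S \<odot> forget) (U \<odot> forget) action)"
  define \<beta> where "\<beta> = whiskerR base.counit (adj_L S \<odot>
    (forget :: (('b, 'm) tower_obj, 'm, ('b, 'm) tower_obj, 'm) cat_functor))"
  have \<alpha>: "\<alpha> P = Comp A (base.Lo (base.Ro (Lo (underlying P)))) (base.Lo (Uo (underlying P)))
      (Lo (underlying P)) (\<pi> (underlying P))
      (base.La (base.Ro (Lo (underlying P))) (Uo (underlying P)) (action P))" for P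
    by (simp add: \<alpha>_def F_def vcomp_def whiskerL_def whiskerR_def)
  have \<beta>: "\<beta> P = base.counit (Lo (underlying P))" for P
    by (simp add: \<beta>_def whiskerR_def)
  have \<rho>: "\<rho> Z = base.Ra (Lo (Ro Z)) Z (counit Z)" for Z
    by (simp add: \<rho>_def whiskerL_def)
  have T: "is_functor C base.C T"
    unfolding T_def by (rule comp_is_functor[OF L_functor base.R_functor])
  have cat': "is_category C'"
    unfolding C'_def by (rule structured_category_is_category[OF T U])
  have obj': "P \<in> Obj C' \<Longrightarrow> underlying P \<in> Obj C \<and>
      action P \<in> Hom base.C (base.Ro (Lo (underlying P))) (Uo (underlying P))" for P
    by (auto simp: C'_def T_def)
  have hom': "f \<in> Hom C' P P' \<longleftrightarrow> f \<in> Hom C (underlying P) (underlying P') \<and>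
      Comp base.C (base.Ro (Lo (underlying P))) (Uo (underlying P)) (Uo (underlying P')) f (action P) =
      Comp base.C (base.Ro (Lo (underlying P))) (base.Ro (Lo (underlying P'))) (Uo (underlying P'))
        (action P')
        (base.Ra (Lo (underlying P)) (Lo (underlying P')) (La (underlying P) (underlying P') f))"
    for f P P'
    by (simp add: C'_def T_def structured_hom_iff FA_U)
  have id_comp': "Id C' P = Id C (underlying P)"
    "Comp C' P P' P'' = Comp C (underlying P) (underlying P') (underlying P'')" for P P' P''
    by (simp_all add: C'_def)
  have forget: "is_functor C' C forget"
    using cats(2) cat' obj' hom' id_comp' by (intro forget_is_functor) simp_all
  have R': "is_functor A C' (comparison (adj_R S) \<rho>)"
  proof (rule comparison_is_functor[OF R_functor cat'])
    fix Z assume Z: "Z \<in> Obj A"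
    show "Ext (Ro Z) (\<rho> Z) \<in> Obj C'"
      using Z by (simp add: C'_def T_def \<rho> over_simps UR_obj)
  next
    fix Y Z f assume Y: "Y \<in> Obj A" and Z: "Z \<in> Obj A" and f: "f \<in> Hom A Y Z"
    have "base.Ra (Lo (Ro Y)) Z (Comp A (Lo (Ro Y)) Y Z f (counit Y)) =
        base.Ra (Lo (Ro Y)) Z (Comp A (Lo (Ro Y)) (Lo (Ro Z)) Z (counit Z) (La (Ro Y) (Ro Z) (Ra Y Z f)))"
      using Y Z f by (simp add: counit_square)
    then show "Ra Y Z f \<in> Hom C' (Ext (Ro Y) (\<rho> Y)) (Ext (Ro Z) (\<rho> Z))"
      using Y Z f fun_hom[OF R_functor f Y Z]
      by (simp add: hom' \<rho> over_simps base.comp_simps UR_obj R_arrow)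
  qed (simp_all add: id_comp')
  have F: "is_functor C' A F"
    unfolding F_def by (intro comp_is_functor[OF forget] comp_is_functor[OF L_functor]
        comp_is_functor[OF base.R_functor] base.L_functor)
  have G: "is_functor C' A (adj_L S \<odot> forget)"
    by (rule comp_is_functor[OF forget L_functor])
  have \<alpha>_nat: "is_nat_trans C' A F (adj_L S \<odot> forget) \<alpha>"
    unfolding is_nat_trans_def
  proof (intro conjI ballI)
    fix P P' f assume P: "P \<in> Obj C'" and P': "P' \<in> Obj C'" and f: "f \<in> Hom C' P P'"
    let ?X = "underlying P" and ?X' = "underlying P'"
    let ?RL = "base.Ro (Lo ?X)" and ?RL' = "base.Ro (Lo ?X')"
    let ?LUX = "base.Lo (Uo ?X)" and ?LUX' = "base.Lo (Uo ?X')"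
    have sq: "Comp base.C ?RL (Uo ?X) (Uo ?X') f (action P) =
        Comp base.C ?RL ?RL' (Uo ?X') (action P') (base.Ra (Lo ?X) (Lo ?X') (La ?X ?X' f))"
      using f by (simp add: hom')
    have f': "f \<in> Hom C ?X ?X'" using f by (simp add: hom')
    note mem = obj'[OF P] obj'[OF P'] f' U_hom[OF f']
    have "Comp A (base.Lo ?RL) (Lo ?X) (Lo ?X') (La ?X ?X' f) (\<alpha> P) =
        Comp A (base.Lo ?RL) ?LUX (Lo ?X') (Comp A ?LUX (Lo ?X) (Lo ?X') (La ?X ?X' f) (\<pi> ?X))
          (base.La ?RL (Uo ?X) (action P))"
      using mem by (simp add: \<alpha> over_simps cat_assoc)
    also have "\<dots> = Comp A (base.Lo ?RL) ?LUX (Lo ?X') (Comp A ?LUX ?LUX' (Lo ?X') (\<pi> ?X') (base.La (Uo ?X) (Uo ?X') f))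
          (base.La ?RL (Uo ?X) (action P))"
      using mem by (simp add: \<pi>_square)
    also have "\<dots> = Comp A (base.Lo ?RL) ?LUX' (Lo ?X') (\<pi> ?X')
          (base.La ?RL (Uo ?X') (Comp base.C ?RL (Uo ?X) (Uo ?X') f (action P)))"
      using mem by (simp add: over_simps base.comp_simps cat_assoc)
    also have "\<dots> = Comp A (base.Lo ?RL) (base.Lo ?RL') (Lo ?X') (\<alpha> P')
        (base.La ?RL ?RL' (base.Ra (Lo ?X) (Lo ?X') (La ?X ?X' f)))"
      using mem unfolding sq by (simp add: \<alpha> over_simps base.comp_simps cat_assoc)
    finally show "Comp A (FO F P) (FO (adj_L S \<odot> forget) P) (FO (adj_L S \<odot> forget) P')
        (FA (adj_L S \<odot> forget) P P' f) (\<alpha> P) =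
        Comp A (FO F P) (FO F P') (FO (adj_L S \<odot> forget) P') (\<alpha> P') (FA F P P' f)"
      by (simp add: F_def)
  qed (use obj' in \<open>simp add: F_def \<alpha> over_simps\<close>)
  have \<beta>_nat: "is_nat_trans C' A F (adj_L S \<odot> forget) \<beta>"
    using obj' hom' by (simp add: is_nat_trans_def F_def \<beta> over_simps base.counit_square)
  have iff: "Comp A (FO F P) (Lo (underlying P)) Z h (\<alpha> P) = Comp A (FO F P) (Lo (underlying P)) Z h (\<beta> P) \<longleftrightarrow>
      transpose (underlying P) Z h \<in> Hom C' P (Ext (Ro Z) (\<rho> Z))"
    if P: "P \<in> Obj C'" and Z: "Z \<in> Obj A" and h: "h \<in> Hom A (Lo (underlying P)) Z" for P Z h
  proof -
    let ?X = "underlying P" and ?b = "action P"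
    let ?RL = "base.Ro (Lo ?X)"
    have X: "?X \<in> Obj C" and b: "?b \<in> Hom base.C ?RL (Uo ?X)" using obj'[OF P] by simp_all
    let ?h\<pi> = "Comp A (base.Lo (Uo ?X)) (Lo ?X) Z h (\<pi> ?X)"
    have h\<pi>: "?h\<pi> \<in> Hom A (base.Lo (Uo ?X)) Z" using X Z h by (simp add: over_simps)
    have "Comp A (FO F P) (Lo ?X) Z h (\<alpha> P) = Comp A (FO F P) (Lo ?X) Z h (\<beta> P) \<longleftrightarrow>
        base.transpose ?RL Z (Comp A (base.Lo ?RL) (base.Lo (Uo ?X)) Z ?h\<pi> (base.La ?RL (Uo ?X) ?b)) =
        base.transpose ?RL Z (Comp A (base.Lo ?RL) (Lo ?X) Z h (base.counit (Lo ?X)))"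
      using X b Z h by (simp add: base.transpose_inject F_def \<alpha> \<beta> over_simps cat_assoc)
    also have "\<dots> \<longleftrightarrow> Comp base.C ?RL (Uo ?X) (base.Ro Z) (transpose ?X Z h) ?b = base.Ra (Lo ?X) Z h"
      using X b Z h h\<pi>
      by (simp add: base.transpose_precomp base.transpose_counit transpose_in_base over_simps)
    also have "base.Ra (Lo ?X) Z h =
        Comp base.C ?RL (base.Ro (Lo (Ro Z))) (base.Ro Z) (base.Ra (Lo (Ro Z)) Z (counit Z))
          (base.Ra (Lo ?X) (Lo (Ro Z)) (La ?X (Ro Z) (transpose ?X Z h)))"
      using X Z h transpose_hom[OF X Z h]
        arg_cong[OF untranspose[OF X Z h], of "base.Ra (Lo ?X) Z"]
      by (simp add: over_simps base.comp_simps)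
    also have "Comp base.C ?RL (Uo ?X) (base.Ro Z) (transpose ?X Z h) ?b = \<dots> \<longleftrightarrow>
        transpose ?X Z h \<in> Hom C' P (Ext (Ro Z) (\<rho> Z))"
      using X Z h by (simp add: hom' \<rho> transpose_hom UR_obj)
    finally show ?thesis .
  qed
  interpret tower_step A S cq C' F \<alpha> \<beta> \<rho>
    using cq F G \<alpha>_nat \<beta>_nat forget R' id_comp' iff by unfold_locales
  have S'_eq: "S' = next_adjunction A S C' (comparison (adj_R S) \<rho>) L' q"
    by (simp add: S'_def decomposition_step_def Let_def T_def \<rho>_def C'_def F_def \<alpha>_def \<beta>_def U_def)
  have \<pi>'_eq: "\<pi>' P = Comp A (base.Lo (Uo (underlying P))) (Lo (underlying P)) (FO L' P) (q P)
      (\<pi> (underlying P))" for P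
    by (simp add: \<pi>'_def decomposition_step_def Let_def F_def \<alpha>_def \<beta>_def U_def vcomp_def whiskerR_def)
  have S'_simps: "adj_cat S' = C'" "adj_L S' = L'" "adj_R S' = comparison (adj_R S) \<rho>"
    by (simp_all add: S'_eq next_adjunction_def Let_def)
  have U': "forget_to 0 (Suc n) = U \<odot> forget"
    by (simp add: U_def forget_to_def)
  have "is_nat_trans C' A (adj_L S0 \<odot> (U \<odot> forget)) L' \<pi>'"
    unfolding is_nat_trans_def
  proof (intro conjI ballI)
    fix P P' f assume P: "P \<in> Obj C'" and P': "P' \<in> Obj C'" and f: "f \<in> Hom C' P P'"
    let ?X = "underlying P" and ?X' = "underlying P'"
    let ?LUX = "base.Lo (Uo ?X)" and ?LUX' = "base.Lo (Uo ?X')"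
    note X = obj'[OF P, THEN conjunct1] and X' = obj'[OF P', THEN conjunct1] and f' = forget_hom[OF f P P']
    note mem = P P' f X X' f' L'_fun[OF P] L'_fun[OF P'] L'_fun_hom[OF f P P'] q_hom'[OF P] q_hom'[OF P']
    have "Comp A ?LUX (FO L' P) (FO L' P') (FA L' P P' f) (\<pi>' P) =
        Comp A ?LUX (Lo ?X) (FO L' P') (Comp A (Lo ?X) (FO L' P) (FO L' P') (FA L' P P' f) (q P)) (\<pi> ?X)"
      using mem by (simp add: \<pi>'_eq over_simps cat_assoc)
    also have "\<dots> = Comp A ?LUX (Lo ?X') (FO L' P') (q P')
        (Comp A ?LUX (Lo ?X) (Lo ?X') (La ?X ?X' f) (\<pi> ?X))"
      using mem by (simp add: q_square' over_simps cat_assoc)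
    also have "\<dots> = Comp A ?LUX ?LUX' (FO L' P') (\<pi>' P') (base.La (Uo ?X) (Uo ?X') f)"
      using mem U_hom[OF f' X X']
      by (simp add: \<pi>'_eq over_simps cat_assoc flip: \<pi>_square)
    finally show "Comp A (FO (adj_L S0 \<odot> (U \<odot> forget)) P) (FO L' P) (FO L' P') (FA L' P P' f) (\<pi>' P) =
        Comp A (FO (adj_L S0 \<odot> (U \<odot> forget)) P) (FO (adj_L S0 \<odot> (U \<odot> forget)) P') (FO L' P')
          (\<pi>' P') (FA (adj_L S0 \<odot> (U \<odot> forget)) P P' f)"
      by (simp add: FA_U)
  qed (use obj' q_hom' L'_fun in \<open>simp add: \<pi>'_eq over_simps\<close>)
  moreover have "adj_unit S' P = base.transpose (Uo (underlying P)) (FO L' P) (\<pi>' P)"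
    if P: "P \<in> Obj C'" for P
    using transpose_in_base[of "underlying P" "FO L' P" "q P"] obj'[OF P] L'_fun[OF P] q_hom'[OF P]
    by (simp add: S'_eq unit'_eq \<pi>'_eq)
  moreover have "functor_eq A (U \<odot> forget \<odot> comparison (adj_R S) \<rho>) (adj_R S0)"
    using UR by (simp add: functor_eq_def)
  moreover have "is_adjunction A S'"
    using next_is_adjunction by (simp add: S'_eq)
  ultimately show ?thesis
    using comp_is_functor[OF forget U] base.adj
    by unfold_locales (simp_all add: S'_simps U' FA_U)
qed

end

end

lemma base_adjunction_is_adjunction:
  assumes "is_adjunction A S"
  shows "is_adjunction A (base_adjunction S)"
proof -
  interpret adjoint_pair A S by (rule adjoint_pair.intro[OF assms])
  define B0 where "B0 = adj_cat (base_adjunction S)"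
  have B0: "is_category B0"
    using cats(2) by (auto simp: B0_def base_adjunction_def Let_def is_category_def)
  show ?thesis
    using B0 cats L_functor R_functor unit_nat counit_nat
    by (auto simp: B0_def base_adjunction_def Let_def is_adjunction_def is_functor_def is_nat_trans_def
        vcomp_def whiskerL_def whiskerR_def id_trans_def triangle_L triangle_R)
qed

lemma decomposition_lies_over:
  assumes S: "is_adjunction A S" and cq: "coequalizer_choice A cq"
  shows "lies_over A (base_adjunction S) (adjoint_decomposition A cq S n) (forget_to 0 n)
    (snd (decomposition_stage A cq S n))"
proof (induction n)
  case 0
  interpret adjoint_pair A "base_adjunction S"
    by (rule adjoint_pair.intro[OF base_adjunction_is_adjunction[OF S]])
  have "is_nat_trans C A (adj_L (base_adjunction S) \<odot> id_functor) (adj_L (base_adjunction S))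
      (id_trans A (adj_L (base_adjunction S)))"
    by (simp add: is_nat_trans_def id_trans_def mem_simps comp_simps)
  moreover have "unit X = transpose X (Lo X) (id_trans A (adj_L (base_adjunction S)) X)"
    if "X \<in> Obj C" for X
    using that by (simp add: transpose_def id_trans_def mem_simps comp_simps)
  ultimately show ?case
    using id_is_functor[OF cats(2)]
    by unfold_locales (simp_all add: adjoint_decomposition_def forget_to_def adj functor_eq_def)
next
  case (Suc n)
  then show ?case
    using lies_over.decomposition_step_lies_over[OF Suc cq refl]
    by (simp add: adjoint_decomposition_def)
qed

section \<open>The mate of a fully faithful functor\<close>

context adjoint_pair
begin

lemma transpose_counit_L:
  assumes X: "X \<in> Obj C" and Z: "Z \<in> Obj A" and f: "f \<in> Hom C X (Ro Z)"
  shows "transpose X Z (Comp A (Lo X) (Lo (Ro Z)) Z (counit Z) (La X (Ro Z) f)) = f"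
  using X Z f transpose_precomp[of "Ro Z" Z "counit Z" X f]
  by (simp add: mem_simps transpose_def[of "Ro Z"] triangle_R comp_simps)

lemma transpose_postcomp:
  assumes "X \<in> Obj C" "Y \<in> Obj A" "Z \<in> Obj A" "h \<in> Hom A (Lo X) Y" "k \<in> Hom A Y Z"
  shows "transpose X Z (Comp A (Lo X) Y Z k h) = Comp C X (Ro Y) (Ro Z) (Ra Y Z k) (transpose X Y h)"
  using assms by (simp add: transpose_def mem_simps comp_simps cat_assoc)

lemma transpose_id: "X \<in> Obj C \<Longrightarrow> transpose X (Lo X) (Id A (Lo X)) = unit X"
  by (simp add: transpose_def mem_simps comp_simps)

end

locale adjoint_comparison = S: adjoint_pair A S + S': adjoint_pair A S'
  for A :: "('a, 'k) category" and S :: "('o, 'm, 'a, 'k) adjunction"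
    and S' :: "('p, 'l, 'a, 'k) adjunction" +
  fixes \<Lambda> :: "('o, 'm, 'p, 'l) cat_functor"
  assumes \<Lambda>: "is_functor S.C S'.C \<Lambda>"
    and \<Lambda>R: "functor_eq A (\<Lambda> \<odot> adj_R S) (adj_R S')"
begin

abbreviation "\<Lambda>o \<equiv> FO \<Lambda>"
abbreviation "\<Lambda>a \<equiv> FA \<Lambda>"
abbreviation "lam \<equiv> mate A S S' \<Lambda>"

lemma \<Lambda>R_obj: "Z \<in> Obj A \<Longrightarrow> \<Lambda>o (S.Ro Z) = S'.Ro Z"
  and \<Lambda>R_arrow: "f \<in> Hom A Y Z \<Longrightarrow> Y \<in> Obj A \<Longrightarrow> Z \<in> Obj A \<Longrightarrow>
    \<Lambda>a (S.Ro Y) (S.Ro Z) (S.Ra Y Z f) = S'.Ra Y Z f"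
  using \<Lambda>R by (simp_all add: functor_eq_def)

lemmas both_simps = S.mem_simps S'.mem_simps fun_obj[OF \<Lambda>] fun_hom[OF \<Lambda>]

lemma \<Lambda>_unit_hom: "X \<in> Obj S.C \<Longrightarrow>
    \<Lambda>a X (S.Ro (S.Lo X)) (S.unit X) \<in> Hom S'.C (\<Lambda>o X) (S'.Ro (S.Lo X))"
  using fun_hom[OF \<Lambda> S.unit_hom] by (simp add: both_simps \<Lambda>R_obj)

lemma lam_eq:
  "X \<in> Obj S.C \<Longrightarrow> lam X =
    Comp A (S'.Lo (\<Lambda>o X)) (S'.Lo (S'.Ro (S.Lo X))) (S.Lo X) (S'.counit (S.Lo X))
      (S'.La (\<Lambda>o X) (S'.Ro (S.Lo X)) (\<Lambda>a X (S.Ro (S.Lo X)) (S.unit X)))"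
  by (simp add: mate_def vcomp_def whiskerL_def whiskerR_def both_simps \<Lambda>R_obj)

lemma lam_hom: "X \<in> Obj S.C \<Longrightarrow> lam X \<in> Hom A (S'.Lo (\<Lambda>o X)) (S.Lo X)"
  by (simp add: lam_eq both_simps \<Lambda>_unit_hom)

lemma transpose_lam: "X \<in> Obj S.C \<Longrightarrow>
    S'.transpose (\<Lambda>o X) (S.Lo X) (lam X) = \<Lambda>a X (S.Ro (S.Lo X)) (S.unit X)"
  by (simp add: lam_eq S'.transpose_counit_L both_simps \<Lambda>_unit_hom)

text \<open>Precomposition with the mate is the bijection
  \<open>Hom (L X, Z) = Hom (X, R Z) \<rightarrow> Hom (\<Lambda> X, R' Z) = Hom (L' \<Lambda> X, Z)\<close> given by \<open>\<Lambda>\<close>, up to transposition.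
  The other facts on the mate follow by applying this to a suitable \<open>h\<close>.\<close>

lemma \<Lambda>_transpose:
  assumes X: "X \<in> Obj S.C" and Z: "Z \<in> Obj A" and h: "h \<in> Hom A (S.Lo X) Z"
  shows "S'.transpose (\<Lambda>o X) Z (Comp A (S'.Lo (\<Lambda>o X)) (S.Lo X) Z h (lam X)) =
    \<Lambda>a X (S.Ro Z) (S.transpose X Z h)"
  using X Z h lam_hom[OF X] fun_comp[OF \<Lambda> S.unit_hom[OF X] fun_hom[OF S.R_functor h]]
  by (simp add: S'.transpose_postcomp both_simps transpose_lam S.transpose_def \<Lambda>R_obj \<Lambda>R_arrow)

lemma counit_lam:
  assumes Z: "Z \<in> Obj A"
  shows "Comp A (S'.Lo (S'.Ro Z)) (S.Lo (S.Ro Z)) Z (S.counit Z) (lam (S.Ro Z)) = S'.counit Z"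
proof -
  have "S'.transpose (S'.Ro Z) Z (Comp A (S'.Lo (S'.Ro Z)) (S.Lo (S.Ro Z)) Z (S.counit Z) (lam (S.Ro Z))) =
      \<Lambda>a (S.Ro Z) (S.Ro Z) (S.transpose (S.Ro Z) Z (S.counit Z))"
    using Z \<Lambda>_transpose[of "S.Ro Z" Z "S.counit Z"] by (simp add: both_simps \<Lambda>R_obj)
  also have "\<dots> = S'.transpose (S'.Ro Z) Z (S'.counit Z)"
    using Z by (simp add: S.transpose_def S'.transpose_def S.triangle_R S'.triangle_R both_simps
        fun_id[OF \<Lambda>] \<Lambda>R_obj)
  finally show ?thesis
    using Z lam_hom[of "S.Ro Z"] by (simp add: S'.transpose_inject both_simps \<Lambda>R_obj)
qed

lemma lam_nat: "is_nat_trans S.C A (adj_L S' \<odot> \<Lambda>) (adj_L S) lam"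
  unfolding is_nat_trans_def
proof (intro conjI ballI)
  fix X Y f assume X: "X \<in> Obj S.C" and Y: "Y \<in> Obj S.C" and f: "f \<in> Hom S.C X Y"
  note mem = X Y f lam_hom[OF X] lam_hom[OF Y]
  have "S'.transpose (\<Lambda>o X) (S.Lo Y) (Comp A (S'.Lo (\<Lambda>o X)) (S.Lo X) (S.Lo Y) (S.La X Y f) (lam X)) =
      \<Lambda>a X (S.Ro (S.Lo Y)) (S.transpose X (S.Lo Y) (S.La X Y f))"
    using mem by (simp add: \<Lambda>_transpose both_simps)
  also have "S.transpose X (S.Lo Y) (S.La X Y f) = Comp S.C X Y (S.Ro (S.Lo Y)) (S.unit Y) f"
    using mem by (simp add: S.transpose_def S.unit_square)
  also have "\<Lambda>a X (S.Ro (S.Lo Y)) \<dots> =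
      S'.transpose (\<Lambda>o X) (S.Lo Y) (Comp A (S'.Lo (\<Lambda>o X)) (S'.Lo (\<Lambda>o Y)) (S.Lo Y) (lam Y)
        (S'.La (\<Lambda>o X) (\<Lambda>o Y) (\<Lambda>a X Y f)))"
    using mem by (simp add: S'.transpose_precomp transpose_lam both_simps fun_comp[OF \<Lambda>] \<Lambda>R_obj)
  finally show "Comp A (FO (adj_L S' \<odot> \<Lambda>) X) (S.Lo X) (S.Lo Y) (S.La X Y f) (lam X) =
      Comp A (FO (adj_L S' \<odot> \<Lambda>) X) (FO (adj_L S' \<odot> \<Lambda>) Y) (S.Lo Y) (lam Y) (FA (adj_L S' \<odot> \<Lambda>) X Y f)"
    using mem by (simp add: S'.transpose_inject both_simps)
qed (simp add: lam_hom)

lemma lam_square: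
  "f \<in> Hom S.C X Y \<Longrightarrow> X \<in> Obj S.C \<Longrightarrow> Y \<in> Obj S.C \<Longrightarrow>
   Comp A (S'.Lo (\<Lambda>o X)) (S'.Lo (\<Lambda>o Y)) (S.Lo Y) (lam Y) (S'.La (\<Lambda>o X) (\<Lambda>o Y) (\<Lambda>a X Y f)) =
   Comp A (S'.Lo (\<Lambda>o X)) (S.Lo X) (S.Lo Y) (S.La X Y f) (lam X)"
  using nat_square[OF lam_nat] by simp

text \<open>The inverse \<open>k : L X \<rightarrow> L' \<Lambda> X\<close> is the morphism corresponding to the identity of \<open>L' \<Lambda> X\<close>: its
  transpose is the preimage under \<open>\<Lambda>\<close> of the unit \<open>\<Lambda> X \<rightarrow> R' L' \<Lambda> X = \<Lambda> R L' \<Lambda> X\<close>.\<close>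

lemma lam_invertible:
  assumes ff: "fully_faithful S.C S'.C \<Lambda>" and X: "X \<in> Obj S.C"
  obtains k where "k \<in> Hom A (S.Lo X) (S'.Lo (\<Lambda>o X))"
    and "Comp A (S'.Lo (\<Lambda>o X)) (S.Lo X) (S'.Lo (\<Lambda>o X)) k (lam X) = Id A (S'.Lo (\<Lambda>o X))"
    and "Comp A (S.Lo X) (S'.Lo (\<Lambda>o X)) (S.Lo X) (lam X) k = Id A (S.Lo X)"
proof -
  let ?X' = "\<Lambda>o X"
  let ?Q = "S'.Lo ?X'"
  have X': "?X' \<in> Obj S'.C" and Q: "?Q \<in> Obj A" and LX: "S.Lo X \<in> Obj A"
    using X by (simp_all add: both_simps)
  have bij: "bij_betw (\<Lambda>a X (S.Ro Z)) (Hom S.C X (S.Ro Z)) (Hom S'.C ?X' (S'.Ro Z))"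
    if "Z \<in> Obj A" for Z
    using ff X that fun_obj[OF S.R_functor that]
    by (metis fully_faithful_def \<Lambda>R_obj)
  obtain g where g: "g \<in> Hom S.C X (S.Ro ?Q)" and \<Lambda>g: "\<Lambda>a X (S.Ro ?Q) g = S'.unit ?X'"
    using S'.unit_hom[OF X'] unfolding bij_betw_imp_surj_on[OF bij[OF Q], symmetric] by auto
  define k where "k = Comp A (S.Lo X) (S.Lo (S.Ro ?Q)) ?Q (S.counit ?Q) (S.La X (S.Ro ?Q) g)"
  have k: "k \<in> Hom A (S.Lo X) ?Q"
    using X Q g by (simp add: k_def both_simps)
  have tk: "S.transpose X ?Q k = g"
    using X Q g by (simp add: k_def S.transpose_counit_L)
  note mem = X X' Q LX k g lam_hom[OF X]
  have "S'.transpose ?X' ?Q (Comp A ?Q (S.Lo X) ?Q k (lam X)) = S'.transpose ?X' ?Q (Id A ?Q)"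
    using mem by (simp add: \<Lambda>_transpose tk \<Lambda>g S'.transpose_id)
  then have 1: "Comp A ?Q (S.Lo X) ?Q k (lam X) = Id A ?Q"
    using mem by (simp add: S'.transpose_inject both_simps)
  have "\<Lambda>a X (S.Ro (S.Lo X)) (S.transpose X (S.Lo X) (Comp A (S.Lo X) ?Q (S.Lo X) (lam X) k)) =
      \<Lambda>a X (S.Ro (S.Lo X)) (S.unit X)"
  proof -
    have "\<Lambda>a X (S.Ro (S.Lo X)) (S.transpose X (S.Lo X) (Comp A (S.Lo X) ?Q (S.Lo X) (lam X) k)) =
        S'.transpose ?X' (S.Lo X) (Comp A ?Q ?Q (S.Lo X) (lam X) (Comp A ?Q (S.Lo X) ?Q k (lam X)))"
      using mem \<Lambda>_transpose[of X "S.Lo X" "Comp A (S.Lo X) ?Q (S.Lo X) (lam X) k"]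
      by (simp add: both_simps cat_assoc)
    then show ?thesis
      using mem by (simp add: 1 both_simps cat_id_right transpose_lam)
  qed
  then have "S.transpose X (S.Lo X) (Comp A (S.Lo X) ?Q (S.Lo X) (lam X) k) = S.unit X"
    using bij[OF LX] mem
    by (auto simp: bij_betw_def S.transpose_hom both_simps dest!: inj_onD)
  then have "S.transpose X (S.Lo X) (Comp A (S.Lo X) ?Q (S.Lo X) (lam X) k) =
      S.transpose X (S.Lo X) (Id A (S.Lo X))"
    using X by (simp add: S.transpose_id)
  then have 2: "Comp A (S.Lo X) ?Q (S.Lo X) (lam X) k = Id A (S.Lo X)"
    using mem by (simp add: S.transpose_inject both_simps)
  from that[OF k 1 2] show thesis .
qed

lemma lam_nat_iso:
  assumes ff: "fully_faithful S.C S'.C \<Lambda>"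
  shows "is_nat_iso S.C A (adj_L S' \<odot> \<Lambda>) (adj_L S) lam"
proof (rule nat_iso_if_components_invertible[OF comp_is_functor[OF \<Lambda> S'.L_functor] S.L_functor lam_nat])
  fix X assume "X \<in> Obj S.C"
  from lam_invertible[OF ff this] show "\<exists>k\<in>Hom A (S.Lo X) (FO (adj_L S' \<odot> \<Lambda>) X).
      Comp A (FO (adj_L S' \<odot> \<Lambda>) X) (S.Lo X) (FO (adj_L S' \<odot> \<Lambda>) X) k (lam X) =
        Id A (FO (adj_L S' \<odot> \<Lambda>) X) \<and>
      Comp A (S.Lo X) (FO (adj_L S' \<odot> \<Lambda>) X) (S.Lo X) (lam X) k = Id A (S.Lo X)"
    by auto
qed

end

section \<open>The embedding of the monadic tower into the decomposition\<close>

text \<open>\<open>\<Lambda>' (X, \<mu>) = (\<Lambda> X, \<mu> \<circ> R (\<lambda> X))\<close>.  The codomain of \<open>\<mu>\<close> is \<open>U X = U \<Lambda> X\<close>, as the composite is one of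
  \<open>\<B>\<close>.\<close>

definition extend_embedding ::
  "('a, 'k) category \<Rightarrow> (('b, 'm) tower_obj, 'm, 'a, 'k) adjunction \<Rightarrow>
   (('b, 'm) tower_obj, 'm, ('b, 'm) tower_obj, 'm) cat_functor \<Rightarrow>
   (('b, 'm) tower_obj, 'm, 'a, 'k) adjunction \<Rightarrow> (('b, 'm) tower_obj, 'm, 'a, 'k) adjunction \<Rightarrow>
   (('b, 'm) tower_obj, 'm, ('b, 'm) tower_obj, 'm) cat_functor \<Rightarrow>
   (('b, 'm) tower_obj, 'm, ('b, 'm) tower_obj, 'm) cat_functor" where
  "extend_embedding A S0 U M D \<Lambda> =
     (let R = adj_R S0; K = FO (adj_L D \<odot> \<Lambda>); L = FO (adj_L M) in
      \<lparr>FO = (\<lambda>P. let X = underlying P in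
          Ext (FO \<Lambda> X)
            (Comp (adj_cat S0) (FO R (K X)) (FO R (L X)) (FO U X) (action P)
              (FA R (K X) (L X) (mate A M D \<Lambda> X)))),
       FA = (\<lambda>P P' f. f)\<rparr>)"

primrec embedding ::
  "('a, 'k) category \<Rightarrow> ('a, 'k) coequalizers \<Rightarrow> ('b, 'm, 'a, 'k) adjunction \<Rightarrow> nat \<Rightarrow>
   (('b, 'm) tower_obj, 'm, ('b, 'm) tower_obj, 'm) cat_functor" where
  "embedding A cq S 0 = id_functor"
| "embedding A cq S (Suc n) = extend_embedding A (base_adjunction S) (forget_to 0 n)
     (monadic_tower A cq S n) (adjoint_decomposition A cq S n) (embedding A cq S n)"

lemma monadic_step_simps:
  "P \<in> Obj (adj_cat (monadic_step A cq S)) \<longleftrightarrow>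
     (\<exists>V \<mu>. P = Ext V \<mu> \<and> V \<in> Obj (adj_cat S) \<and>
        \<mu> \<in> Hom (adj_cat S) (FO (adj_R S) (FO (adj_L S) V)) V \<and>
        Comp (adj_cat S) V (FO (adj_R S) (FO (adj_L S) V)) V \<mu> (adj_unit S V) = Id (adj_cat S) V \<and>
        Comp (adj_cat S) (FO (adj_R S) (FO (adj_L S) (FO (adj_R S) (FO (adj_L S) V))))
          (FO (adj_R S) (FO (adj_L S) V)) V \<mu>
          (FA (adj_R S) (FO (adj_L S) (FO (adj_R S) (FO (adj_L S) V))) (FO (adj_L S) V)
            (FA (adj_L S) (FO (adj_R S) (FO (adj_L S) V)) V \<mu>)) =
        Comp (adj_cat S) (FO (adj_R S) (FO (adj_L S) (FO (adj_R S) (FO (adj_L S) V))))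
          (FO (adj_R S) (FO (adj_L S) V)) V \<mu>
          (FA (adj_R S) (FO (adj_L S) (FO (adj_R S) (FO (adj_L S) V))) (FO (adj_L S) V)
            (adj_counit S (FO (adj_L S) V))))"
  "Hom (adj_cat (monadic_step A cq S)) =
     Hom (structured_category (adj_cat S) (adj_cat S) (adj_R S \<odot> adj_L S) id_functor)"
  "Id (adj_cat (monadic_step A cq S)) P = Id (adj_cat S) (underlying P)"
  "Comp (adj_cat (monadic_step A cq S)) P P' P'' =
     Comp (adj_cat S) (underlying P) (underlying P') (underlying P'')"
  "adj_R (monadic_step A cq S) =
     comparison (adj_R S) (whiskerL (adj_R S) (adj_L S \<odot> adj_R S) id_functor (adj_counit S))"
  by (simp_all add: monadic_step_def next_adjunction_def Let_def whiskerL_def whiskerR_def)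

lemma decomposition_step_simps:
  "adj_cat (fst (decomposition_step A cq S0 n (S, \<pi>))) =
     structured_category (adj_cat S0) (adj_cat S) (adj_R S0 \<odot> adj_L S) (forget_to 0 n)"
  "adj_R (fst (decomposition_step A cq S0 n (S, \<pi>))) =
     comparison (adj_R S) (whiskerL (adj_R S0) (adj_L S \<odot> adj_R S) id_functor (adj_counit S))"
  by (simp_all add: decomposition_step_def next_adjunction_def Let_def)

text \<open>The induction hypothesis, with \<open>M\<close> and \<open>D\<close> the stages of the two towers.  As \<open>\<Lambda>\<close> does not change
  morphisms, full faithfulness is an equality of hom-sets.  The functor \<open>U\<close> serves as forgetful
  functor on both sides.\<close>

locale stage_embedding =
  D: lies_over A S0 D U \<pi> + adjoint_comparison A M D \<Lambda>
  for A :: "('a, 'k) category" and S0 D :: "(('b, 'm) tower_obj, 'm, 'a, 'k) adjunction"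
    and U \<pi> and M :: "(('b, 'm) tower_obj, 'm, 'a, 'k) adjunction" and \<Lambda> +
  assumes FA_\<Lambda>: "\<And>X Y f. FA \<Lambda> X Y f = f"
    and U\<Lambda>: "\<And>X. X \<in> Obj (adj_cat M) \<Longrightarrow> FO U (FO \<Lambda> X) = FO U X"
    and Hom_\<Lambda>: "\<And>X Y. X \<in> Obj (adj_cat M) \<Longrightarrow> Y \<in> Obj (adj_cat M) \<Longrightarrow>
      Hom (adj_cat D) (FO \<Lambda> X) (FO \<Lambda> Y) = Hom (adj_cat M) X Y"
    and inj_\<Lambda>: "inj_on (FO \<Lambda>) (Obj (adj_cat M))"
begin

abbreviation "B0 \<equiv> D.base.C"
abbreviation "Ro \<equiv> D.base.Ro"
abbreviation "Ra \<equiv> D.base.Ra"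

lemma fully_faithful_\<Lambda>: "fully_faithful S.C D.C \<Lambda>"
  by (simp add: fully_faithful_def Hom_\<Lambda> FA_\<Lambda> bij_betw_def inj_on_def)

lemma UM_obj: "X \<in> Obj S.C \<Longrightarrow> D.Uo X \<in> Obj B0"
  using D.U_obj[of "\<Lambda>o X"] by (simp add: fun_obj[OF \<Lambda>] U\<Lambda>)

lemma UM_hom: "f \<in> Hom S.C X Y \<Longrightarrow> X \<in> Obj S.C \<Longrightarrow> Y \<in> Obj S.C \<Longrightarrow> f \<in> Hom B0 (D.Uo X) (D.Uo Y)"
  using D.U_hom[of f "\<Lambda>o X" "\<Lambda>o Y"] by (simp add: fun_obj[OF \<Lambda>] U\<Lambda> Hom_\<Lambda>)

lemma compM_in_base:
  "f \<in> Hom S.C X Y \<Longrightarrow> g \<in> Hom S.C Y Z \<Longrightarrow> X \<in> Obj S.C \<Longrightarrow> Y \<in> Obj S.C \<Longrightarrow> Z \<in> Obj S.C \<Longrightarrow>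
   Comp S.C X Y Z g f = Comp B0 (D.Uo X) (D.Uo Y) (D.Uo Z) g f"
  using fun_comp[OF \<Lambda>, of f X Y g Z] D.comp_in_base[of f "\<Lambda>o X" "\<Lambda>o Y" g "\<Lambda>o Z"]
  by (simp add: FA_\<Lambda> Hom_\<Lambda> fun_obj[OF \<Lambda>] U\<Lambda>)

lemma UMR_obj: "Z \<in> Obj A \<Longrightarrow> D.Uo (S.Ro Z) = Ro Z"
  using D.UR_obj U\<Lambda>[of "S.Ro Z"] \<Lambda>R_obj by (simp add: S.mem_simps)

lemma MR_arrow: "f \<in> Hom A Y Z \<Longrightarrow> Y \<in> Obj A \<Longrightarrow> Z \<in> Obj A \<Longrightarrow> S.Ra Y Z f = Ra Y Z f"
  using \<Lambda>R_arrow[of f Y Z] D.R_arrow by (simp add: FA_\<Lambda>)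

lemma MR_hom: "f \<in> Hom A Y Z \<Longrightarrow> Y \<in> Obj A \<Longrightarrow> Z \<in> Obj A \<Longrightarrow> Ra Y Z f \<in> Hom S.C (S.Ro Y) (S.Ro Z)"
  using fun_hom[OF S.R_functor] MR_arrow by metis

lemma R_lam_epi:
  assumes X: "X \<in> Obj S.C" and W: "W \<in> Obj B0"
    and g: "g \<in> Hom B0 (Ro (S.Lo X)) W" and h: "h \<in> Hom B0 (Ro (S.Lo X)) W"
  shows "Comp B0 (Ro (D.Lo (\<Lambda>o X))) (Ro (S.Lo X)) W g (Ra (D.Lo (\<Lambda>o X)) (S.Lo X) (lam X)) =
      Comp B0 (Ro (D.Lo (\<Lambda>o X))) (Ro (S.Lo X)) W h (Ra (D.Lo (\<Lambda>o X)) (S.Lo X) (lam X))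
      \<longleftrightarrow> g = h" (is "?c g = ?c h \<longleftrightarrow> _")
proof -
  let ?K = "D.Lo (\<Lambda>o X)" and ?L = "S.Lo X"
  obtain k where k: "k \<in> Hom A ?L ?K" and lk: "Comp A ?L ?K ?L (lam X) k = Id A ?L"
    by (rule lam_invertible[OF fully_faithful_\<Lambda> X])
  have "Comp B0 (Ro ?L) (Ro ?K) W (?c u) (Ra ?L ?K k) = u" if u: "u \<in> Hom B0 (Ro ?L) W" for u
  proof -
    have "Comp B0 (Ro ?L) (Ro ?K) W (?c u) (Ra ?L ?K k) =
        Comp B0 (Ro ?L) (Ro ?L) W u (Ra ?L ?L (Comp A ?L ?K ?L (lam X) k))"
      using X W u k lam_hom[OF X]
      by (simp add: both_simps D.base.mem_simps D.base.comp_simps cat_assoc)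
    then show ?thesis
      using X W u by (simp add: lk both_simps D.base.mem_simps D.base.comp_simps)
  qed
  then show ?thesis using g h by metis
qed

context
  fixes cq :: "('a, 'k) coequalizers" and n :: nat
  assumes cq: "coequalizer_choice A cq" and U_def: "U = forget_to 0 n"
begin

lemma stage_embedding_step:
  "stage_embedding A S0 (fst (decomposition_step A cq S0 n (D, \<pi>))) (forget_to 0 (Suc n))
     (snd (decomposition_step A cq S0 n (D, \<pi>))) (monadic_step A cq M)
     (extend_embedding A S0 U M D \<Lambda>)"
proof -
  define D' where "D' = fst (decomposition_step A cq S0 n (D, \<pi>))"
  define \<pi>' where "\<pi>' = snd (decomposition_step A cq S0 n (D, \<pi>))"
  define M' where "M' = monadic_step A cq M"
  define \<Lambda>' where "\<Lambda>' = extend_embedding A S0 U M D \<Lambda>"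
  interpret D': lies_over A S0 D' "forget_to 0 (Suc n)" \<pi>'
    using D.decomposition_step_lies_over[OF cq U_def] by (simp add: D'_def \<pi>'_def)
  interpret M': adjoint_pair A M'
    unfolding M'_def by (rule adjoint_pair.intro[OF monadic_step_is_adjunction[OF S.adj cq]])
  let ?K = "\<lambda>X. D.Lo (\<Lambda>o X)" and ?L = "S.Lo"
  define b where "b X \<mu> = Comp B0 (Ro (?K X)) (Ro (?L X)) (D.Uo X) \<mu> (Ra (?K X) (?L X) (lam X))" for X \<mu>
  have \<Lambda>': "FO \<Lambda>' (Ext X \<mu>) = Ext (\<Lambda>o X) (b X \<mu>)" "FA \<Lambda>' P P' f = f" for X \<mu> P P' f
    by (simp_all add: \<Lambda>'_def extend_embedding_def Let_def b_def)
  have M'_obj: "\<exists>X \<mu>. P = Ext X \<mu> \<and> X \<in> Obj S.C \<and> \<mu> \<in> Hom S.C (S.Ro (?L X)) X \<and>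
      \<mu> \<in> Hom B0 (Ro (?L X)) (D.Uo X)" if "P \<in> Obj M'.C" for P
  proof -
    from that obtain X \<mu> where P: "P = Ext X \<mu>" and X: "X \<in> Obj S.C" and \<mu>: "\<mu> \<in> Hom S.C (S.Ro (?L X)) X"
      unfolding M'_def monadic_step_simps by blast
    with UM_hom[OF \<mu>] show ?thesis by (simp add: both_simps UMR_obj)
  qed
  have M'_hom: "f \<in> Hom M'.C (Ext X \<mu>) (Ext X' \<mu>') \<longleftrightarrow> f \<in> Hom S.C X X' \<and>
      Comp S.C (S.Ro (?L X)) X X' f \<mu> =
      Comp S.C (S.Ro (?L X)) (S.Ro (?L X')) X' \<mu>' (S.Ra (?L X) (?L X') (S.La X X' f))" for f X \<mu> X' \<mu>'
    by (simp add: M'_def monadic_step_simps structured_hom_iff)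
  have M'_ops: "Id M'.C P = Id S.C (underlying P)"
    "Comp M'.C P P' P'' = Comp S.C (underlying P) (underlying P') (underlying P'')"
    "adj_R M' = comparison (adj_R M) (\<lambda>Z. S.Ra (S.Lo (S.Ro Z)) Z (S.counit Z))" for P P' P''
    by (simp_all add: M'_def monadic_step_simps whiskerL_def)
  have D'_simps: "adj_cat D' = structured_category B0 D.C (adj_R S0 \<odot> adj_L D) U"
    "adj_R D' = comparison (adj_R D) (\<lambda>Z. Ra (D.Lo (D.Ro Z)) Z (D.counit Z))"
    by (simp_all add: D'_def decomposition_step_simps U_def whiskerL_def)
  have b_hom: "b X \<mu> \<in> Hom B0 (Ro (?K X)) (D.Uo X)"
    if "X \<in> Obj S.C" "\<mu> \<in> Hom B0 (Ro (?L X)) (D.Uo X)" for X \<mu>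
    using that lam_hom by (simp add: b_def both_simps D.base.mem_simps UM_obj)
  have Hom': "Hom D'.C (FO \<Lambda>' P) (FO \<Lambda>' P') = Hom M'.C P P'"
    if P: "P \<in> Obj M'.C" and P': "P' \<in> Obj M'.C" for P P'
  proof (rule set_eqI)
    fix f
    obtain X \<mu> X' \<mu>' where eqs: "P = Ext X \<mu>" "P' = Ext X' \<mu>'"
      and X: "X \<in> Obj S.C" "X' \<in> Obj S.C"
      and \<mu>: "\<mu> \<in> Hom S.C (S.Ro (?L X)) X" "\<mu>' \<in> Hom S.C (S.Ro (?L X')) X'"
      and \<mu>B: "\<mu> \<in> Hom B0 (Ro (?L X)) (D.Uo X)" "\<mu>' \<in> Hom B0 (Ro (?L X')) (D.Uo X')"
      using M'_obj[OF P] M'_obj[OF P'] by blast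
    have "Comp B0 (Ro (?K X)) (D.Uo X) (D.Uo X') f (b X \<mu>) =
        Comp B0 (Ro (?K X)) (Ro (?K X')) (D.Uo X') (b X' \<mu>')
          (Ra (?K X) (?K X') (D.La (\<Lambda>o X) (\<Lambda>o X') f)) \<longleftrightarrow>
        Comp S.C (S.Ro (?L X)) X X' f \<mu> =
        Comp S.C (S.Ro (?L X)) (S.Ro (?L X')) X' \<mu>' (S.Ra (?L X) (?L X') (S.La X X' f))"
      (is "?l = ?r \<longleftrightarrow> ?l' = ?r'")
      if f: "f \<in> Hom S.C X X'"
    proof -
      have f': "f \<in> Hom D.C (\<Lambda>o X) (\<Lambda>o X')" using f X by (simp add: Hom_\<Lambda>)
      note mem = X \<mu>B f f' UM_hom[OF f X] UM_obj lam_hom both_simps D.base.mem_simps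
      have l': "?l' = Comp B0 (Ro (?L X)) (D.Uo X) (D.Uo X') f \<mu>"
        using X \<mu> f by (simp add: compM_in_base both_simps UMR_obj)
      have r': "?r' = Comp B0 (Ro (?L X)) (Ro (?L X')) (D.Uo X') \<mu>' (Ra (?L X) (?L X') (S.La X X' f))"
        using X \<mu> f by (simp add: compM_in_base both_simps UMR_obj MR_arrow MR_hom)
      have "?l = Comp B0 (Ro (?K X)) (Ro (?L X)) (D.Uo X') ?l' (Ra (?K X) (?L X) (lam X))"
        unfolding l' using mem by (simp add: b_def cat_assoc)
      moreover have "?r = Comp B0 (Ro (?K X)) (Ro (?L X)) (D.Uo X') ?r' (Ra (?K X) (?L X) (lam X))"
      proof -
        have "?r = Comp B0 (Ro (?K X)) (Ro (?L X')) (D.Uo X') \<mu>'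
            (Ra (?K X) (?L X') (Comp A (?K X) (?K X') (?L X') (lam X') (D.La (\<Lambda>o X) (\<Lambda>o X') f)))"
          using mem by (simp add: b_def cat_assoc D.base.comp_simps)
        also have "Comp A (?K X) (?K X') (?L X') (lam X') (D.La (\<Lambda>o X) (\<Lambda>o X') f) =
            Comp A (?K X) (?L X) (?L X') (S.La X X' f) (lam X)"
          using lam_square[OF f X] by (simp add: FA_\<Lambda>)
        finally show ?thesis
          unfolding r' using mem by (simp add: cat_assoc D.base.comp_simps)
      qed
      moreover have "?l' \<in> Hom B0 (Ro (?L X)) (D.Uo X')" "?r' \<in> Hom B0 (Ro (?L X)) (D.Uo X')"
        unfolding l' r' using X \<mu>B f UM_hom[OF f X]
        by (simp_all add: UM_obj both_simps D.base.mem_simps)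
      ultimately show ?thesis
        using R_lam_epi[OF X(1) UM_obj[OF X(2)], of ?l' ?r'] by simp
    qed
    then show "f \<in> Hom D'.C (FO \<Lambda>' P) (FO \<Lambda>' P') \<longleftrightarrow> f \<in> Hom M'.C P P'"
      using X by (auto simp: eqs \<Lambda>' D'_simps structured_hom_iff M'_hom Hom_\<Lambda> U\<Lambda> D.FA_U)
  qed
  have obj': "FO \<Lambda>' P \<in> Obj D'.C" if "P \<in> Obj M'.C" for P
    using M'_obj[OF that] b_hom fun_obj[OF \<Lambda>] by (auto simp: \<Lambda>' D'_simps U\<Lambda>)
  have "inj_on (FO \<Lambda>') (Obj M'.C)"
  proof (rule inj_onI)
    fix P P' assume P: "P \<in> Obj M'.C" and P': "P' \<in> Obj M'.C" and eq: "FO \<Lambda>' P = FO \<Lambda>' P'"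
    obtain X \<mu> X' \<mu>' where eqs: "P = Ext X \<mu>" "P' = Ext X' \<mu>'"
      and X: "X \<in> Obj S.C" "X' \<in> Obj S.C"
      and \<mu>B: "\<mu> \<in> Hom B0 (Ro (?L X)) (D.Uo X)" "\<mu>' \<in> Hom B0 (Ro (?L X')) (D.Uo X')"
      using M'_obj[OF P] M'_obj[OF P'] by blast
    have "X = X'" using eq X inj_\<Lambda> by (simp add: eqs \<Lambda>' inj_on_def)
    moreover from this have "\<mu> = \<mu>'"
      using eq R_lam_epi[OF X(1) UM_obj[OF X(1)] \<mu>B(1), of \<mu>'] \<mu>B(2) by (simp add: eqs \<Lambda>' b_def)
    ultimately show "P = P'" by (simp add: eqs)
  qed
  moreover have "functor_eq A (\<Lambda>' \<odot> adj_R M') (adj_R D')"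
    unfolding functor_eq_def
  proof (intro conjI ballI)
    fix Z assume Z: "Z \<in> Obj A"
    have "b (S.Ro Z) (S.Ra (S.Lo (S.Ro Z)) Z (S.counit Z)) =
        Ra (D.Lo (D.Ro Z)) Z (Comp A (D.Lo (D.Ro Z)) (S.Lo (S.Ro Z)) Z (S.counit Z) (lam (S.Ro Z)))"
      using Z lam_hom[of "S.Ro Z"]
      by (simp add: b_def MR_arrow both_simps D.base.comp_simps UMR_obj \<Lambda>R_obj)
    then show "FO (\<Lambda>' \<odot> adj_R M') Z = FO (adj_R D') Z"
      using Z by (simp add: M'_ops D'_simps \<Lambda>' counit_lam \<Lambda>R_obj)
  next
    fix Y Z f assume "Y \<in> Obj A" "Z \<in> Obj A" "f \<in> Hom A Y Z"
    then show "FA (\<Lambda>' \<odot> adj_R M') Y Z f = FA (adj_R D') Y Z f"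
      using \<Lambda>R_arrow[of f Y Z] by (simp add: M'_ops D'_simps \<Lambda>' FA_\<Lambda>)
  qed
  moreover have "is_functor M'.C D'.C \<Lambda>'"
  proof -
    have "Id M'.C P = Id D'.C (FO \<Lambda>' P)" if "P \<in> Obj M'.C" for P
      using M'_obj[OF that] fun_id[OF \<Lambda>] by (auto simp: M'_ops D'_simps \<Lambda>' FA_\<Lambda>)
    moreover have "Comp M'.C P P' P'' g f = Comp D'.C (FO \<Lambda>' P) (FO \<Lambda>' P') (FO \<Lambda>' P'') g f"
      if "P \<in> Obj M'.C" "P' \<in> Obj M'.C" "P'' \<in> Obj M'.C" "f \<in> Hom M'.C P P'" "g \<in> Hom M'.C P' P''"
      for P P' P'' f g
      using M'_obj[OF that(1)] M'_obj[OF that(2)] M'_obj[OF that(3)] that(4,5)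
        fun_comp[OF \<Lambda>, of f "underlying P" "underlying P'" g "underlying P''"]
      by (auto simp: M'_ops D'_simps \<Lambda>' FA_\<Lambda> M'_hom)
    ultimately show ?thesis
      using M'.cats D'.cats obj' Hom' by (auto simp: is_functor_def \<Lambda>')
  qed
  moreover have "FO (forget_to 0 (Suc n)) (FO \<Lambda>' P) = FO (forget_to 0 (Suc n)) P"
    if "P \<in> Obj M'.C" for P
    using M'_obj[OF that] U\<Lambda> by (auto simp: \<Lambda>' forget_to_def U_def)
  ultimately show ?thesis
    unfolding D'_def[symmetric] \<pi>'_def[symmetric] M'_def[symmetric] \<Lambda>'_def[symmetric]
    using Hom' by unfold_locales (simp_all add: \<Lambda>')
qed

end

end

lemma embedding_is_stage_embedding:
  assumes S: "is_adjunction A S" and cq: "coequalizer_choice A cq"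
  shows "stage_embedding A (base_adjunction S) (adjoint_decomposition A cq S n) (forget_to 0 n)
    (snd (decomposition_stage A cq S n)) (monadic_tower A cq S n) (embedding A cq S n)"
proof (induction n)
  case 0
  interpret lies_over A "base_adjunction S" "adjoint_decomposition A cq S 0" "forget_to 0 0"
      "snd (decomposition_stage A cq S 0)"
    by (rule decomposition_lies_over[OF S cq])
  show ?case
    using id_is_functor[OF cats(2)] adj
    by unfold_locales (simp_all add: adjoint_decomposition_def functor_eq_def inj_on_def)
next
  case (Suc n)
  from stage_embedding.stage_embedding_step[OF Suc cq refl] show ?case
    by (simp add: adjoint_decomposition_def)
qed

section \<open>The first stage\<close>

text \<open>At stage 1 the decomposition forms \<open>\<pi>\<^bsub>[0]\<^esub> \<circ> L b\<close> with \<open>\<pi>\<^bsub>[0]\<^esub>\<close> an identity.  This agrees with \<open>L \<mu>\<close>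
  only at objects of \<open>\<B>\<^sub>1\<close>, where \<open>L \<mu>\<close> is a morphism with the expected source and target; so the
  coequalizer functors have to be compared object by object.\<close>

lemma coeq_functor_cong:
  assumes "\<alpha> X = \<alpha>' X" and "\<alpha> Y = \<alpha>' Y"
  shows "FO (coeq_functor A cq F G \<alpha> \<beta>) X = FO (coeq_functor A cq F G \<alpha>' \<beta>) X"
    and "coeq_proj cq F G \<alpha> \<beta> X = coeq_proj cq F G \<alpha>' \<beta> X"
    and "FA (coeq_functor A cq F G \<alpha> \<beta>) X Y f = FA (coeq_functor A cq F G \<alpha>' \<beta>) X Y f"
  using assms by (simp_all add: coeq_functor_def coeq_proj_def Let_def)

context adjoint_pair
begin

lemma mate_self:
  assumes "X \<in> Obj C"
  shows "mate A S S id_functor X = Id A (Lo X)"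
  using assms by (simp add: mate_def vcomp_def whiskerL_def whiskerR_def triangle_L)

end

context
  fixes A :: "('a, 'k) category" and S :: "(('b, 'm) tower_obj, 'm, 'a, 'k) adjunction"
    and cq :: "('a, 'k) coequalizers"
  assumes adj: "is_adjunction A S" and cq: "coequalizer_choice A cq"
begin

interpretation adjoint_pair A S by (rule adjoint_pair.intro[OF adj])

abbreviation (input) "M1 \<equiv> monadic_step A cq S"
abbreviation (input) "D1 \<equiv> fst (decomposition_step A cq S 0 (S, id_trans A (adj_L S)))"
abbreviation (input) "\<Lambda>1 \<equiv> extend_embedding A S (forget_to 0 0) S S id_functor"

lemma first_stage_agrees:
  assumes P: "P \<in> Obj (adj_cat M1)" and P': "P' \<in> Obj (adj_cat M1)"
  shows "FO (adj_L D1) P = FO (adj_L M1) P" and "FA (adj_L D1) P P' f = FA (adj_L M1) P P' f"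
    and "FO \<Lambda>1 P = P"
proof -
  have actions: "Comp A (Lo (Ro (Lo (underlying Q)))) (Lo (underlying Q)) (Lo (underlying Q))
      (Id A (Lo (underlying Q))) (La (Ro (Lo (underlying Q))) (underlying Q) (action Q)) =
      La (Ro (Lo (underlying Q))) (underlying Q) (action Q)"
    if "Q \<in> Obj (adj_cat M1)" for Q
    using that by (auto simp: monadic_step_simps mem_simps cat_id_left)
  show "FO (adj_L D1) P = FO (adj_L M1) P" and "FA (adj_L D1) P P' f = FA (adj_L M1) P P' f"
    unfolding monadic_step_def decomposition_step_def next_adjunction_def Let_def fst_conv snd_conv
      adjunction.simps forget_to_def
    using actions[OF P] actions[OF P']
    by (intro coeq_functor_cong; simp add: vcomp_def whiskerL_def whiskerR_def id_trans_def)+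
  from P obtain X \<mu> where "P = Ext X \<mu>" "X \<in> Obj C" "\<mu> \<in> Hom C (Ro (Lo X)) X"
    by (auto simp: monadic_step_simps)
  then show "FO \<Lambda>1 P = P"
    by (simp add: extend_embedding_def Let_def mate_self forget_to_def mem_simps comp_simps)
qed

lemma first_counit_agrees:
  assumes Z: "Z \<in> Obj A"
  shows "adj_counit D1 Z = adj_counit M1 Z"
proof -
  interpret M1: adjoint_pair A M1
    by (rule adjoint_pair.intro[OF monadic_step_is_adjunction[OF adj cq]])
  let ?P = "Ext (Ro Z) (Ra (Lo (Ro Z)) Z (counit Z))"
  have P: "?P \<in> Obj M1.C"
    using fun_obj[OF M1.R_functor Z] by (simp add: monadic_step_simps(5) whiskerL_def)
  then have "Comp A (Lo (Ro (Lo (Ro Z)))) (Lo (Ro Z)) (Lo (Ro Z)) (Id A (Lo (Ro Z)))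
      (La (Ro (Lo (Ro Z))) (Ro Z) (Ra (Lo (Ro Z)) Z (counit Z))) =
      La (Ro (Lo (Ro Z))) (Ro Z) (Ra (Lo (Ro Z)) Z (counit Z))"
    using Z by (simp add: mem_simps cat_id_left)
  then show ?thesis
    by (simp add: monadic_step_def decomposition_step_def next_adjunction_def Let_def whiskerL_def
        whiskerR_def vcomp_def id_trans_def forget_to_def coeq_functor_def coeq_proj_def)
qed

lemma first_mate:
  assumes P: "P \<in> Obj (adj_cat M1)"
  shows "mate A M1 D1 \<Lambda>1 P = Id A (FO (adj_L M1) P)"
proof -
  interpret M1: adjoint_pair A M1
    by (rule adjoint_pair.intro[OF monadic_step_is_adjunction[OF adj cq]])
  have R: "adj_R D1 = adj_R M1"
    by (simp add: monadic_step_simps decomposition_step_simps)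
  have RL: "M1.Ro (M1.Lo P) \<in> Obj M1.C"
    using P by (simp add: M1.mem_simps)
  have "FA \<Lambda>1 X Y f = f" for X Y f
    by (simp add: extend_embedding_def Let_def)
  then have "mate A M1 D1 \<Lambda>1 P = Comp A (M1.Lo P) (M1.Lo (M1.Ro (M1.Lo P))) (M1.Lo P)
      (M1.counit (M1.Lo P)) (M1.La P (M1.Ro (M1.Lo P)) (M1.unit P))"
    using P RL fun_obj[OF M1.L_functor P]
    by (simp add: mate_def vcomp_def whiskerL_def whiskerR_def R first_stage_agrees first_counit_agrees)
  then show ?thesis
    using P by (simp add: M1.triangle_L)
qed

end

theorem mainTheorem2:
  fixes A :: "('a, 'k) category"
    and B :: "('b, 'm) category"
    and L :: "('b, 'm, 'a, 'k) cat_functor"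
    and R :: "('a, 'k, 'b, 'm) cat_functor"
    and \<eta> :: "'b \<Rightarrow> 'm"
    and \<epsilon> :: "'a \<Rightarrow> 'k"
    and cq :: "('a, 'k) coequalizers"
    and S :: "('b, 'm, 'a, 'k) adjunction"
  assumes "is_category A" and "is_category B"
    and "coequalizer_choice A cq"
    and S: "S = \<lparr>adj_cat = B, adj_L = L, adj_R = R, adj_unit = \<eta>, adj_counit = \<epsilon>\<rparr>"
    and "is_adjunction A S"
  shows
    "let M = monadic_tower A cq S;
         D = adjoint_decomposition A cq S
     in \<exists>\<Lambda> :: nat \<Rightarrow> (('b, 'm) tower_obj, 'm, ('b, 'm) tower_obj, 'm) cat_functor.
          (\<forall>n. is_functor (adj_cat (M n)) (adj_cat (D n)) (\<Lambda> n)) \<and>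
          functor_eq (adj_cat (M 0)) (\<Lambda> 0) id_functor \<and>
          functor_eq (adj_cat (M 1)) (\<Lambda> 1) id_functor \<and>
          (\<forall>n. functor_eq A (\<Lambda> n \<odot> adj_R (M n)) (adj_R (D n))) \<and>
          (\<forall>n\<ge>1. functor_eq (adj_cat (M n))
                    (forget_to (n - 1) n \<odot> \<Lambda> n) (\<Lambda> (n - 1) \<odot> forget_to (n - 1) n)) \<and>
          (\<forall>n. functor_eq (adj_cat (M n)) (forget_to 0 n \<odot> \<Lambda> n) (forget_to 0 n)) \<and>
          (\<forall>n. is_nat_iso (adj_cat (M n)) A (adj_L (D n) \<odot> \<Lambda> n) (adj_L (M n))
                 (mate A (M n) (D n) (\<Lambda> n))) \<and>
          functor_eq (adj_cat (M 1)) (adj_L (D 1) \<odot> \<Lambda> 1) (adj_L (M 1)) \<and>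
          (\<forall>X\<in>Obj (adj_cat (M 1)).
             mate A (M 1) (D 1) (\<Lambda> 1) X = id_trans A (adj_L (M 1)) X) \<and>
          (\<forall>n. fully_faithful (adj_cat (M n)) (adj_cat (D n)) (\<Lambda> n) \<and>
               inj_on (FO (\<Lambda> n)) (Obj (adj_cat (M n))))"
proof -
  note adj = \<open>is_adjunction A S\<close> and cq = \<open>coequalizer_choice A cq\<close>
  define M where "M = monadic_tower A cq S"
  define D where "D = adjoint_decomposition A cq S"
  define \<Lambda> where "\<Lambda> = embedding A cq S"
  interpret E: stage_embedding A "base_adjunction S" "D n" "forget_to 0 n"
      "snd (decomposition_stage A cq S n)" "M n" "\<Lambda> n" for n
    unfolding D_def M_def \<Lambda>_def by (rule embedding_is_stage_embedding[OF adj cq])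
  note adj0 = base_adjunction_is_adjunction[OF adj]
  have M1: "M 1 = monadic_step A cq (base_adjunction S)"
    and D1: "D 1 = fst (decomposition_step A cq (base_adjunction S) 0
      (base_adjunction S, id_trans A (adj_L (base_adjunction S))))"
    and \<Lambda>1: "\<Lambda> 1 = extend_embedding A (base_adjunction S) (forget_to 0 0) (base_adjunction S)
      (base_adjunction S) id_functor"
    by (simp_all add: M_def D_def \<Lambda>_def adjoint_decomposition_def)
  note first = first_stage_agrees[OF adj0 cq, folded M1 D1 \<Lambda>1]
    and first_mate = first_mate[OF adj0 cq, folded M1 D1 \<Lambda>1]
  have "functor_eq (adj_cat (M 0)) (\<Lambda> 0) id_functor"
    by (simp add: \<Lambda>_def functor_eq_def)
  moreover have "functor_eq (adj_cat (M 1)) (\<Lambda> 1) id_functor"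
    using first(3) by (simp add: functor_eq_def E.FA_\<Lambda> del: One_nat_def)
  moreover have "functor_eq (adj_cat (M n)) (forget_to (n - 1) n \<odot> \<Lambda> n) (\<Lambda> (n - 1) \<odot> forget_to (n - 1) n)"
    if "n \<ge> 1" for n
  proof -
    from that obtain m where "n = Suc m" by (cases n) auto
    then show ?thesis
      by (simp add: functor_eq_def E.FA_\<Lambda> forget_to_def)
        (simp add: \<Lambda>_def extend_embedding_def Let_def)
  qed
  moreover have "functor_eq (adj_cat (M n)) (forget_to 0 n \<odot> \<Lambda> n) (forget_to 0 n)" for n
    by (simp add: functor_eq_def E.FA_\<Lambda> E.U\<Lambda>)
  moreover have "functor_eq (adj_cat (M 1)) (adj_L (D 1) \<odot> \<Lambda> 1) (adj_L (M 1))"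
    using first by (simp add: functor_eq_def E.FA_\<Lambda> del: One_nat_def)
  moreover have "mate A (M 1) (D 1) (\<Lambda> 1) X = id_trans A (adj_L (M 1)) X" if "X \<in> Obj (adj_cat (M 1))" for X
    using first_mate[OF that] by (simp add: id_trans_def)
  ultimately show ?thesis
    unfolding Let_def M_def[symmetric] D_def[symmetric]
    using E.\<Lambda> E.\<Lambda>R E.lam_nat_iso[OF E.fully_faithful_\<Lambda>] E.fully_faithful_\<Lambda> E.inj_\<Lambda>
    by (intro exI[of _ \<Lambda>]) simp
qed

end
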